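(* Let $U=U_1\times\cdots\times U_m$ with $U_i=\{0,1,\dots,|U_i|-1\}$ finite and nonempty for each $i$. A set $S\subseteq U$ is ample if and only if every serial push down commutes on $S$, i.e., for any sequence of one-dimensional minor-subproducts $M^1,M^2,\dots,M^k$ of $U$ with pairwise distinct supports and any permutation $M^{i_1},M^{i_2},\dots,M^{i_k}$ of it, we have $S[M^1,M^2,\dots,M^k\downarrow]=S[M^{i_1},M^{i_2},\dots,M^{i_k}\downarrow]$.
   Context: A generalized partition of $U$ is a tuple $\Lambda=(\alpha_1,\dots,\alpha_m)$ with $\alpha_i$ a partition of $U_i$ into nonempty blocks. It defines a partition of $U$ into the boxes $P^1\times\cdots\times P^m$, $P^i\in\alpha_i$, and the minor-subproduct $M=M(\Lambda)=M_1\times\cdots\times M_m$, where $M_i$ is the set of blocks of $\alpha_i$. The support of $M$ is the set of $i$ such that $\alpha_i$ has a non-singleton block; $M$ is one-dimensional if its support has exactly one element. $M(\Lambda)$ is shattered by $S\subseteq U$ if $S$ meets every box of the box-partition. A copy of $M(\Lambda)$ is a set $W_1\times\cdots\times W_m$ where $W_i$ consists of exactly one element from each block of $\alpha_i$. $M(\Lambda)$ is strongly shattered by $S$ if $S$ contains a copy of it. $S$ is ample if every minor-subproduct of $U$ shattered by $S$ is strongly shattered by $S$. Push down: let $M$ be one-dimensional with support $\{i\}$. Every box $B$ of its box-partition consists of tuples which differ only in their $i$-th coordinate. $S[M\downarrow]$ is the set such that, for every box $B$ of the box-partition, $S[M\downarrow]\cap B$ consists of the $|S\cap B|$ elements of $B$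 with the smallest $i$-th coordinates. The serial push down is $S[M^1,\dots,M^k\downarrow]=S[M^1\downarrow][M^2\downarrow]\cdots[M^k\downarrow]$ (applied from left to right). *)

theory Defs
  imports "HOL-Combinatorics.Permutations" "HOL-Library.Disjoint_Sets" "HOL-Library.FuncSet"
begin

text \<open>
  The coordinates are \<open>1, \<dots>, m\<close>, the \<open>i\<close>-th factor is \<open>{..<n i}\<close>, and tuples are extensional
  functions on \<open>{1..m}\<close>.
\<close>

definition universe :: "nat \<Rightarrow> (nat \<Rightarrow> nat) \<Rightarrow> (nat \<Rightarrow> nat) set" where
  "universe m n = (\<Pi>\<^sub>E i\<in>{1..m}. {..<n i})"

definition generalized_partition ::
    "nat \<Rightarrow> (nat \<Rightarrow> nat) \<Rightarrow> (nat \<Rightarrow> nat set set) \<Rightarrow> bool" where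
  "generalized_partition m n \<Lambda> \<longleftrightarrow> (\<forall>i\<in>{1..m}. partition_on {..<n i} (\<Lambda> i))"

text \<open>
  A minor-subproduct is handled through the generalized partition \<open>\<Lambda>\<close> that defines it: a product
  of nonempty sets determines its factors. A point of it is a tuple of blocks, and
  the box belonging to that point is the product of those blocks.
\<close>

definition minor_subproduct :: "nat \<Rightarrow> (nat \<Rightarrow> nat set set) \<Rightarrow> (nat \<Rightarrow> nat set) set" where
  "minor_subproduct m \<Lambda> = (\<Pi>\<^sub>E i\<in>{1..m}. \<Lambda> i)"

definition boxes :: "nat \<Rightarrow> (nat \<Rightarrow> nat set set) \<Rightarrow> (nat \<Rightarrow> nat) set set" where
  "boxes m \<Lambda> = (\<lambda>P. \<Pi>\<^sub>E i\<in>{1..m}. P i) ` minor_subproduct m \<Lambda>"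

definition support :: "nat \<Rightarrow> (nat \<Rightarrow> nat set set) \<Rightarrow> nat set" where
  "support m \<Lambda> = {i\<in>{1..m}. \<exists>P\<in>\<Lambda> i. \<not> is_singleton P}"

definition one_dimensional :: "nat \<Rightarrow> (nat \<Rightarrow> nat set set) \<Rightarrow> bool" where
  "one_dimensional m \<Lambda> \<longleftrightarrow> is_singleton (support m \<Lambda>)"

definition shattered :: "nat \<Rightarrow> (nat \<Rightarrow> nat set set) \<Rightarrow> (nat \<Rightarrow> nat) set \<Rightarrow> bool" where
  "shattered m \<Lambda> S \<longleftrightarrow> (\<forall>B\<in>boxes m \<Lambda>. S \<inter> B \<noteq> {})"

definition copies :: "nat \<Rightarrow> (nat \<Rightarrow> nat set set) \<Rightarrow> (nat \<Rightarrow> nat) set set" where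
  "copies m \<Lambda> = {(\<Pi>\<^sub>E i\<in>{1..m}. W i) | W.
     \<forall>i\<in>{1..m}. W i \<subseteq> \<Union>(\<Lambda> i) \<and> (\<forall>P\<in>\<Lambda> i. is_singleton (W i \<inter> P))}"

definition strongly_shattered :: "nat \<Rightarrow> (nat \<Rightarrow> nat set set) \<Rightarrow> (nat \<Rightarrow> nat) set \<Rightarrow> bool" where
  "strongly_shattered m \<Lambda> S \<longleftrightarrow> (\<exists>C\<in>copies m \<Lambda>. C \<subseteq> S)"

definition ample :: "nat \<Rightarrow> (nat \<Rightarrow> nat) \<Rightarrow> (nat \<Rightarrow> nat) set \<Rightarrow> bool" where
  "ample m n S \<longleftrightarrow>
     (\<forall>\<Lambda>. generalized_partition m n \<Lambda> \<longrightarrow> shattered m \<Lambda> S \<longrightarrow> strongly_shattered m \<Lambda> S)"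

text \<open>
  The \<open>k\<close> elements of \<open>B\<close> with the smallest \<open>i\<close>-th coordinates, when the \<open>i\<close>-th coordinates of the
  elements of \<open>B\<close> are distinct and \<open>k \<le> card B\<close>: an element is among them iff fewer than \<open>k\<close>
  elements of \<open>B\<close> precede it. The lemmas \<open>card_lowest\<close>, \<open>lowest_less\<close> and \<open>lowest_unique\<close> confirm
  this.
\<close>

definition lowest :: "nat \<Rightarrow> nat \<Rightarrow> (nat \<Rightarrow> nat) set \<Rightarrow> (nat \<Rightarrow> nat) set" where
  "lowest i k B = {x\<in>B. card {y\<in>B. y i < x i} < k}"

text \<open>
  Only meaningful for one-dimensional \<open>\<Lambda>\<close>; then \<open>the_elem (support m \<Lambda>)\<close> is the
  coordinate in which the elements of a box differ.
\<close>

definition push_down ::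
    "nat \<Rightarrow> (nat \<Rightarrow> nat) set \<Rightarrow> (nat \<Rightarrow> nat set set) \<Rightarrow> (nat \<Rightarrow> nat) set" where
  "push_down m S \<Lambda> = (\<Union>B\<in>boxes m \<Lambda>. lowest (the_elem (support m \<Lambda>)) (card (S \<inter> B)) B)"

definition serial_push_down ::
    "nat \<Rightarrow> (nat \<Rightarrow> nat) set \<Rightarrow> (nat \<Rightarrow> nat set set) list \<Rightarrow> (nat \<Rightarrow> nat) set" where
  "serial_push_down m S \<Lambda>s = foldl (push_down m) S \<Lambda>s"

lemma lowest_less:
  assumes "finite B" "x \<in> lowest i k B" "y \<in> B - lowest i k B"
  shows "x i < y i"
proof (rule ccontr)
  assume "\<not> x i < y i"
  then have "{z\<in>B. z i < y i} \<subseteq> {z\<in>B. z i < x i}" by auto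
  then have "card {z\<in>B. z i < y i} \<le> card {z\<in>B. z i < x i}"
    using assms(1) by (intro card_mono) auto
  then show False using assms(2,3) by (auto simp: lowest_def)
qed

lemma card_lowest:
  assumes "finite B" "inj_on (\<lambda>x. x i) B" "k \<le> card B"
  shows "card (lowest i k B) = k"
proof -
  define r where "r x = card {y\<in>B. y i < x i}" for x
  have mono: "r x < r y" if "x \<in> B" "y \<in> B" "x i < y i" for x y
    unfolding r_def using assms(1) that by (intro psubset_card_mono) auto
  have inj: "inj_on r B"
  proof (rule inj_onI)
    fix x y assume xy: "x \<in> B" "y \<in> B" "r x = r y"
    then have "x i = y i" using mono[of x y] mono[of y x] by (metis less_irrefl linorder_neqE_nat)
    then show "x = y" using assms(2) xy by (auto dest: inj_onD)
  qed
  have "r ` B \<subseteq> {..<card B}"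
    unfolding r_def using assms(1) by (auto intro!: psubset_card_mono)
  then have img: "r ` B = {..<card B}"
    using inj by (intro card_subset_eq) (auto simp: card_image)
  have "r ` lowest i k B = {..<k}"
  proof
    show "r ` lowest i k B \<subseteq> {..<k}" by (auto simp: lowest_def r_def)
    show "{..<k} \<subseteq> r ` lowest i k B"
    proof
      fix j assume j: "j \<in> {..<k}"
      then have "j \<in> r ` B" using img assms(3) by auto
      then obtain x where "x \<in> B" "j = r x" by auto
      with j show "j \<in> r ` lowest i k B" by (auto simp: lowest_def r_def)
    qed
  qed
  moreover have "inj_on r (lowest i k B)"
    using inj by (rule inj_on_subset) (auto simp: lowest_def)
  ultimately show ?thesis by (metis card_image card_lessThan)
qed

lemma lowest_unique:
  assumes "finite B" "T \<subseteq> B" "\<And>x y. x \<in> T \<Longrightarrow> y \<in> B - T \<Longrightarrow> x i < y i"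
  shows "lowest i (card T) B = T"
proof
  have fin: "finite T" using assms(1,2) finite_subset by blast
  show "T \<subseteq> lowest i (card T) B"
  proof
    fix x assume x: "x \<in> T"
    have "{y\<in>B. y i < x i} \<subseteq> T - {x}" using assms(3) x by (auto dest: less_asym)
    then have "card {y\<in>B. y i < x i} \<le> card (T - {x})" using fin by (intro card_mono) auto
    also have "\<dots> < card T" using fin x by (rule card_Diff1_less)
    finally show "x \<in> lowest i (card T) B" using x assms(2) by (auto simp: lowest_def)
  qed
  show "lowest i (card T) B \<subseteq> T"
  proof
    fix x assume x: "x \<in> lowest i (card T) B"
    show "x \<in> T"
    proof (rule ccontr)
      assume "x \<notin> T"
      then have "T \<subseteq> {y\<in>B. y i < x i}" using assms(2,3) x by (auto simp: lowest_def)
      then have "card T \<le> card {y\<in>B. y i < x i}" using assms(1) by (intro card_mono) auto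
      then show False using x by (simp add: lowest_def)
    qed
  qed
qed

lemma inj_on_box:
  assumes "one_dimensional m \<Lambda>" "B \<in> boxes m \<Lambda>"
  shows "inj_on (\<lambda>x. x (the_elem (support m \<Lambda>))) B"
proof (rule inj_onI)
  fix x y assume xy: "x \<in> B" "y \<in> B"
    and eq: "x (the_elem (support m \<Lambda>)) = y (the_elem (support m \<Lambda>))"
  obtain i where i: "support m \<Lambda> = {i}"
    using assms(1) by (auto simp: one_dimensional_def is_singleton_def)
  obtain P where "P \<in> (\<Pi>\<^sub>E j\<in>{1..m}. \<Lambda> j)" and B: "B = (\<Pi>\<^sub>E j\<in>{1..m}. P j)"
    using assms(2) unfolding boxes_def minor_subproduct_def by blast
  then have P: "P j \<in> \<Lambda> j" if "j \<in> {1..m}" for j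
    using that by auto
  show "x = y"
  proof (rule PiE_ext)
    show "x \<in> (\<Pi>\<^sub>E j\<in>{1..m}. P j)" "y \<in> (\<Pi>\<^sub>E j\<in>{1..m}. P j)" using xy B by auto
    fix j assume j: "j \<in> {1..m}"
    show "x j = y j"
    proof (cases "j = i")
      case True
      then show ?thesis using eq i by simp
    next
      case False
      then have "j \<notin> support m \<Lambda>" using i by simp
      then have "is_singleton (P j)" using P[OF j] j by (auto simp: support_def)
      moreover have "x j \<in> P j" "y j \<in> P j" using xy B j by auto
      ultimately show ?thesis by (auto simp: is_singleton_def)
    qed
  qed
qed

end

theory Submission
  imports Defs
begin

text \<open>
  Both sides are equivalent to the exchange property: whenever \<open>V\<close> is a product of nonempty sets
  whose coordinates are split into \<open>X\<close> and its complement, \<open>\<forall>x. \<exists>y. (x, y) \<in> S\<close> implies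
  \<open>\<exists>y. \<forall>x. (x, y) \<in> S\<close>, where \<open>x\<close> and \<open>y\<close> range over the two parts of \<open>V\<close>.

  Shattering passes to partitions of subsets \<open>V\<^sub>i\<close> of the factors by adding points one at a time, and
  for the partition of \<open>V\<^sub>i\<close> into singletons (\<open>i \<in> X\<close>) or a single block (\<open>i \<notin> X\<close>) it gives the
  exchange property. Conversely, a copy is assembled coordinate by coordinate with the exchange
  property.

  The exchange property survives push downs and says in two coordinates that rows are nested, which
  makes two push downs commute. Conversely, pushing down inside the block \<open>V\<^sub>i\<close> evaluates an
  existential quantifier over \<open>V\<^sub>i\<close> at the point \<open>Min V\<^sub>i\<close> and a universal one at \<open>Max V\<^sub>i\<close>, so the order
  of the push downs is the order of the quantifiers.
\<close>

section \<open>The exchange property\<close>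

text \<open>Both parts of a point are encoded as full tuples of \<open>V\<close>:
  \<open>override_on y x X\<close> reads \<open>x\<close> on \<open>X\<close> and \<open>y\<close>
  elsewhere. Thus no separate product types for the two sets of coordinates appear, and
  \<open>X\<close> can vary within a proof.\<close>

definition exchangeable :: "nat \<Rightarrow> (nat \<Rightarrow> nat) \<Rightarrow> (nat \<Rightarrow> nat) set \<Rightarrow> bool" where
  "exchangeable m n S \<longleftrightarrow>
     (\<forall>V X. (\<forall>i\<in>{1..m}. V i \<noteq> {} \<and> V i \<subseteq> {..<n i}) \<longrightarrow>
        (\<forall>x\<in>PiE {1..m} V. \<exists>y\<in>PiE {1..m} V. override_on y x X \<in> S) \<longrightarrow>
        (\<exists>y\<in>PiE {1..m} V. \<forall>x\<in>PiE {1..m} V. override_on y x X \<in> S))"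

lemma exchangeableD:
  assumes "exchangeable m n S" "\<And>i. i \<in> {1..m} \<Longrightarrow> V i \<noteq> {} \<and> V i \<subseteq> {..<n i}"
    and "\<And>x. x \<in> PiE {1..m} V \<Longrightarrow> \<exists>y\<in>PiE {1..m} V. override_on y x X \<in> S"
  obtains y where "y \<in> PiE {1..m} V" "\<And>x. x \<in> PiE {1..m} V \<Longrightarrow> override_on y x X \<in> S"
proof -
  have "\<exists>y\<in>PiE {1..m} V. \<forall>x\<in>PiE {1..m} V. override_on y x X \<in> S"
    using assms(1)[unfolded exchangeable_def, rule_format, of V X] assms(2,3) by blast
  then show ?thesis using that by blast
qed

lemma fun_upd_in_PiE:
  assumes "x \<in> PiE I V" "k \<in> I" "v \<in> A"
  shows "x(k := v) \<in> PiE I (V(k := A))"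
  using assms by (auto simp: PiE_iff extensional_def)

lemma fun_upd_in_PiE':
  assumes "x \<in> PiE I (V(k := A))" "k \<in> I" "v \<in> V k"
  shows "x(k := v) \<in> PiE I V"
  using fun_upd_in_PiE[OF assms] by simp

lemma override_on_in_PiE:
  assumes "x \<in> PiE I V" "y \<in> PiE I V"
  shows "override_on x y X \<in> PiE I V"
  using assms by (auto simp: PiE_iff extensional_def override_on_def)

text \<open>
  Membership in a push down is a monotone condition \<open>f\<close> on the fibre of \<open>S\<close> through the point. The
  proof compares \<open>f\<close> with its value on the set \<open>Z\<close> of levels where \<open>\<forall>x. \<exists>y\<close> holds: if \<open>f\<close> holds
  there, exchange with \<open>Z\<close> as universal range; otherwise some fibre always leaves \<open>Z\<close>, and exchange
  over the complement of \<open>Z\<close> as existential range produces a level that should be in \<open>Z\<close>.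
\<close>

lemma exchangeable_fibrewise:
  assumes ex: "exchangeable m n S" and k: "k \<in> {1..m}"
    and mono: "\<And>v A B. f v A \<Longrightarrow> A \<subseteq> B \<Longrightarrow> f v B"
    and empty: "\<And>v. \<not> f v {}"
    and T: "\<And>z. z \<in> universe m n \<Longrightarrow> z \<in> T \<longleftrightarrow> f (z k) {v\<in>{..<n k}. z(k := v) \<in> S}"
  shows "exchangeable m n T"
  unfolding exchangeable_def
proof (intro allI impI)
  fix V X
  assume V: "\<forall>i\<in>{1..m}. V i \<noteq> {} \<and> V i \<subseteq> {..<n i}"
    and H: "\<forall>x\<in>PiE {1..m} V. \<exists>y\<in>PiE {1..m} V. override_on y x X \<in> T"
  define Z where "Z = {q\<in>{..<n k}. \<forall>x\<in>PiE {1..m} V. \<exists>y\<in>PiE {1..m} V. (override_on y x X)(k := q) \<in> S}"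
  obtain v0 where v0: "v0 \<in> V k" using V k by blast
  have univ: "PiE {1..m} V \<subseteq> universe m n"
    unfolding universe_def by (rule PiE_mono) (use V in auto)
  have mem: "override_on y x X \<in> T \<longleftrightarrow>
      f (if k \<in> X then x k else y k) {v\<in>{..<n k}. (override_on y x X)(k := v) \<in> S}"
    if "x \<in> PiE {1..m} V" "y \<in> PiE {1..m} V" for x y
  proof -
    have "override_on y x X \<in> universe m n" using override_on_in_PiE[OF that(2,1)] univ by blast
    moreover have "override_on y x X k = (if k \<in> X then x k else y k)" by (simp add: override_on_def)
    ultimately show ?thesis using T[of "override_on y x X"] by simp
  qed
  \<comment> \<open>Here \<open>k\<close> joins the universal coordinates with range
    \<open>Z\<close>, so a single \<open>y\<close> serves all levels of \<open>Z\<close> at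
    once.\<close>
  have uniform: "\<exists>y\<in>PiE {1..m} V. \<forall>x\<in>PiE {1..m} V. \<forall>q\<in>Z. (override_on y x X)(k := q) \<in> S"
    if "Z \<noteq> {}"
  proof -
    obtain y where y: "y \<in> PiE {1..m} (V(k := Z))"
      "\<And>x. x \<in> PiE {1..m} (V(k := Z)) \<Longrightarrow> override_on y x (insert k X) \<in> S"
    proof (rule exchangeableD[OF ex, of "V(k := Z)" "insert k X"])
      show "(V(k := Z)) i \<noteq> {} \<and> (V(k := Z)) i \<subseteq> {..<n i}" if "i \<in> {1..m}" for i
        using that V \<open>Z \<noteq> {}\<close> by (auto simp: Z_def)
      fix x assume x: "x \<in> PiE {1..m} (V(k := Z))"
      have xk: "x k \<in> Z" using PiE_mem[OF x k] by simp
      \<comment> \<open>The value \<open>x k\<close> lies in \<open>Z\<close> but perhaps not in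
        \<open>V k\<close>. Resetting it to \<open>v0\<close> gives a tuple of \<open>V\<close>; the
        coordinate is overwritten by \<open>x k\<close> again afterwards. The default
        \<open>v0\<close> serves the same purpose in the steps below.\<close>
      obtain y where y: "y \<in> PiE {1..m} V" "(override_on y (x(k := v0)) X)(k := x k) \<in> S"
        using xk fun_upd_in_PiE'[OF x k v0] by (auto simp: Z_def)
      have "(override_on y (x(k := v0)) X)(k := x k) = override_on (y(k := x k)) x (insert k X)"
        by (auto simp: override_on_def)
      then show "\<exists>y\<in>PiE {1..m} (V(k := Z)). override_on y x (insert k X) \<in> S"
        using y fun_upd_in_PiE[OF y(1) k xk] by auto
    qed blast
    have "(override_on (y(k := v0)) x X)(k := q) \<in> S" if x: "x \<in> PiE {1..m} V" and q: "q \<in> Z" for x q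
    proof -
      have "(override_on (y(k := v0)) x X)(k := q) = override_on y (x(k := q)) (insert k X)"
        by (auto simp: override_on_def)
      then show ?thesis using y(2)[OF fun_upd_in_PiE[OF x k q]] by simp
    qed
    then show ?thesis using fun_upd_in_PiE'[OF y(1) k v0] by blast
  qed
  have blocked: False
    if H': "\<And>x. x \<in> PiE {1..m} V \<Longrightarrow>
      \<exists>y\<in>PiE {1..m} V. \<exists>q\<in>{..<n k} - Z. (override_on y x X)(k := q) \<in> S"
  proof -
    define R where "R = {..<n k} - Z"
    have witness: "\<exists>y\<in>PiE {1..m} (V(k := R)). override_on y x (X - {k}) \<in> S"
      if x': "x(k := v0) \<in> PiE {1..m} V" for x
    proof -
      obtain y q where y: "y \<in> PiE {1..m} V" "q \<in> R" "(override_on y (x(k := v0)) X)(k := q) \<in> S"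
        using H'[OF x'] by (auto simp: R_def)
      have "(override_on y (x(k := v0)) X)(k := q) = override_on (y(k := q)) x (X - {k})"
        by (auto simp: override_on_def)
      then show ?thesis using y fun_upd_in_PiE[OF y(1) k y(2)] by auto
    qed
    obtain x0 where x0: "x0 \<in> PiE {1..m} V"
      using V by (metis PiE_eq_empty_iff equals0I)
    have "x0(k := v0) \<in> PiE {1..m} V" using fun_upd_in_PiE'[of x0 _ V k "V k"] x0 k v0 by simp
    from witness[OF this] obtain y0 where "y0 \<in> PiE {1..m} (V(k := R))" by blast
    \<comment> \<open>Exchange demands nonempty ranges. A point of the product exists because
      \<open>H'\<close> supplies a level outside \<open>Z\<close> for at least one
      \<open>x\<close>.\<close>
    then have "R \<noteq> {}" using PiE_mem[OF _ k] by fastforce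
    obtain y where y: "y \<in> PiE {1..m} (V(k := R))"
      "\<And>x. x \<in> PiE {1..m} (V(k := R)) \<Longrightarrow> override_on y x (X - {k}) \<in> S"
    proof (rule exchangeableD[OF ex, of "V(k := R)" "X - {k}"])
      show "(V(k := R)) i \<noteq> {} \<and> (V(k := R)) i \<subseteq> {..<n i}" if "i \<in> {1..m}" for i
        using that V \<open>R \<noteq> {}\<close> by (auto simp: R_def)
      show "\<exists>y\<in>PiE {1..m} (V(k := R)). override_on y x (X - {k}) \<in> S"
        if "x \<in> PiE {1..m} (V(k := R))" for x
        using witness fun_upd_in_PiE'[OF that k v0] by blast
    qed blast
    have yk: "y k \<in> R" using PiE_mem[OF y(1) k] by simp
    have "(override_on (y(k := v0)) x X)(k := y k) \<in> S" if x: "x \<in> PiE {1..m} V" for x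
    proof -
      have "(override_on (y(k := v0)) x X)(k := y k) = override_on y (x(k := y k)) (X - {k})"
        by (auto simp: override_on_def)
      then show ?thesis using y(2)[OF fun_upd_in_PiE[OF x k yk]] by simp
    qed
    then have "y k \<in> Z" using yk fun_upd_in_PiE'[OF y(1) k v0] by (auto simp: Z_def R_def)
    then show False using yk by (simp add: R_def)
  qed
  have escape: "\<exists>q\<in>{..<n k} - Z. z(k := q) \<in> S"
    if "f v {q\<in>{..<n k}. z(k := q) \<in> S}" "\<not> f v Z" for v z
    using mono[OF that(1), of Z] that(2) by blast
  \<comment> \<open>The condition \<open>f v\<close> depends on the level \<open>v\<close> of the
    point itself. If \<open>k\<close> is in \<open>X\<close>, that level is universal and
    \<open>f v Z\<close> must hold for all \<open>v\<close> in \<open>V k\<close>; otherwise one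
    such \<open>v\<close> suffices and becomes the new \<open>k\<close>-th coordinate of
    \<open>y\<close>.\<close>
  show "\<exists>y\<in>PiE {1..m} V. \<forall>x\<in>PiE {1..m} V. override_on y x X \<in> T"
  proof (cases "k \<in> X")
    case True
    have fZ: "f v Z" if v: "v \<in> V k" for v
    proof (rule ccontr)
      assume nf: "\<not> f v Z"
      show False
      proof (rule blocked)
        fix x assume x: "x \<in> PiE {1..m} V"
        then have x': "x(k := v) \<in> PiE {1..m} V" using fun_upd_in_PiE'[of x _ V k "V k"] k v by simp
        then obtain y where y: "y \<in> PiE {1..m} V" "override_on y (x(k := v)) X \<in> T" using H by blast
        then have "f v {q\<in>{..<n k}. (override_on y (x(k := v)) X)(k := q) \<in> S}"
          using mem[OF x' y(1)] True by simp
        moreover have "(override_on y (x(k := v)) X)(k := q) = (override_on y x X)(k := q)" for q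
          by (auto simp: override_on_def)
        ultimately show "\<exists>y\<in>PiE {1..m} V. \<exists>q\<in>{..<n k} - Z. (override_on y x X)(k := q) \<in> S"
          using escape[OF _ nf, of "override_on y x X"] y(1) by auto
      qed
    qed
    then have "Z \<noteq> {}" using v0 empty by metis
    then obtain y where y: "y \<in> PiE {1..m} V"
      "\<And>x q. x \<in> PiE {1..m} V \<Longrightarrow> q \<in> Z \<Longrightarrow> (override_on y x X)(k := q) \<in> S"
      using uniform by blast
    have "override_on y x X \<in> T" if x: "x \<in> PiE {1..m} V" for x
    proof -
      have "f (x k) {q\<in>{..<n k}. (override_on y x X)(k := q) \<in> S}"
        by (rule mono[OF fZ]) (use y x k in \<open>auto simp: Z_def\<close>)
      then show ?thesis using mem[OF x y(1)] True by simp
    qed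
    then show ?thesis using y(1) by blast
  next
    case False
    have "\<exists>v\<in>V k. f v Z"
    proof (rule ccontr)
      assume "\<not> (\<exists>v\<in>V k. f v Z)"
      then have nf: "\<not> f v Z" if "v \<in> V k" for v using that by blast
      show False
      proof (rule blocked)
        fix x assume x: "x \<in> PiE {1..m} V"
        then obtain y where y: "y \<in> PiE {1..m} V" "override_on y x X \<in> T" using H by blast
        then have "f (y k) {q\<in>{..<n k}. (override_on y x X)(k := q) \<in> S}"
          using mem[OF x y(1)] False by simp
        then show "\<exists>y\<in>PiE {1..m} V. \<exists>q\<in>{..<n k} - Z. (override_on y x X)(k := q) \<in> S"
          using escape[OF _ nf] PiE_mem[OF y(1) k] y(1) by blast
      qed
    qed
    then obtain v where v: "v \<in> V k" "f v Z" by blast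
    then have "Z \<noteq> {}" using empty by metis
    then obtain y where y: "y \<in> PiE {1..m} V"
      "\<And>x q. x \<in> PiE {1..m} V \<Longrightarrow> q \<in> Z \<Longrightarrow> (override_on y x X)(k := q) \<in> S"
      using uniform by blast
    have y': "y(k := v) \<in> PiE {1..m} V" using fun_upd_in_PiE'[of y _ V k "V k"] y(1) k v by simp
    have "override_on (y(k := v)) x X \<in> T" if x: "x \<in> PiE {1..m} V" for x
    proof -
      have eq: "(override_on (y(k := v)) x X)(k := q) = (override_on y x X)(k := q)" for q
        by (auto simp: override_on_def)
      have "f v {q\<in>{..<n k}. (override_on (y(k := v)) x X)(k := q) \<in> S}"
        unfolding eq by (rule mono[OF v(2)]) (use y x in \<open>auto simp: Z_def\<close>)
      then show ?thesis using mem[OF x y'] False by simp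
    qed
    then show ?thesis using y' by blast
  qed
qed

section \<open>Push downs of exchangeable sets\<close>

lemma block_subset:
  assumes "generalized_partition m n \<Lambda>" "k \<in> {1..m}" "P \<in> \<Lambda> k"
  shows "P \<subseteq> {..<n k}"
  using assms by (auto simp: generalized_partition_def dest!: bspec partition_onD1)

lemma universe_block:
  assumes "generalized_partition m n \<Lambda>" "z \<in> universe m n" "k \<in> {1..m}"
  obtains P where "P \<in> \<Lambda> k" "z k \<in> P" "P \<subseteq> {..<n k}"
proof -
  have "\<Union>(\<Lambda> k) = {..<n k}"
    using assms(1,3) by (auto simp: generalized_partition_def partition_on_def)
  moreover have "z k \<in> {..<n k}" using assms(2,3) by (auto simp: universe_def)
  ultimately show ?thesis using that by blast
qed

lemma boxes_subset_universe:
  assumes "generalized_partition m n \<Lambda>" "B \<in> boxes m \<Lambda>"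
  shows "B \<subseteq> universe m n"
proof -
  obtain C where C: "C \<in> (\<Pi>\<^sub>E j\<in>{1..m}. \<Lambda> j)" "B = (\<Pi>\<^sub>E j\<in>{1..m}. C j)"
    using assms(2) unfolding boxes_def minor_subproduct_def by blast
  show ?thesis unfolding C(2) universe_def
  proof (rule PiE_mono)
    fix i assume "i \<in> {1..m}"
    then show "C i \<subseteq> {..<n i}"
      using block_subset[OF assms(1)] PiE_mem[OF C(1)] by blast
  qed
qed

lemma push_down_subset_universe:
  assumes "generalized_partition m n \<Lambda>"
  shows "push_down m S \<Lambda> \<subseteq> universe m n"
  using boxes_subset_universe[OF assms] by (fastforce simp: push_down_def lowest_def)

text \<open>Off the coordinate \<open>k\<close> every block is a singleton and hence equals
  \<open>{z i}\<close>; at \<open>k\<close>, disjointness leaves only \<open>P\<close>. So the box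
  is a segment of the line through \<open>z\<close> in direction \<open>k\<close>.\<close>

lemma box_through:
  assumes gp: "generalized_partition m n \<Lambda>" and supp: "support m \<Lambda> = {k}"
    and z: "z \<in> universe m n" and P: "P \<in> \<Lambda> k" "z k \<in> P"
  shows "B \<in> boxes m \<Lambda> \<and> z \<in> B \<longleftrightarrow> B = (\<lambda>v. z(k := v)) ` P"
proof -
  have k: "k \<in> {1..m}" using supp by (auto simp: support_def)
  have part: "partition_on {..<n i} (\<Lambda> i)" if "i \<in> {1..m}" for i
    using gp that by (auto simp: generalized_partition_def)
  have zi: "z i \<in> {..<n i}" if "i \<in> {1..m}" for i using z that by (auto simp: universe_def)
  have single: "Q = {z i}" if "i \<in> {1..m}" "i \<noteq> k" "Q \<in> \<Lambda> i" "z i \<in> Q" for i Q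
  proof -
    have "is_singleton Q" using supp that by (auto simp: support_def)
    then show ?thesis using that(4) by (auto simp: is_singleton_def)
  qed
  \<comment> \<open>The tuple of blocks around \<open>z\<close>, made extensional because
    \<open>minor_subproduct\<close> consists of extensional tuples.\<close>
  define C where "C = (\<lambda>i\<in>{1..m}. if i = k then P else {z i})"
  have img: "PiE {1..m} C = (\<lambda>v. z(k := v)) ` P"
  proof (intro equalityI subsetI)
    fix y assume y: "y \<in> PiE {1..m} C"
    have "y = z(k := y k)"
    proof (rule ext)
      fix i show "y i = (z(k := y k)) i"
        using y z by (cases "i \<in> {1..m}") (auto simp: C_def PiE_iff universe_def extensional_def split: if_splits)
    qed
    moreover have "y k \<in> P" using PiE_mem[OF y k] k by (simp add: C_def)
    ultimately show "y \<in> (\<lambda>v. z(k := v)) ` P" by blast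
  next
    fix y assume "y \<in> (\<lambda>v. z(k := v)) ` P"
    then show "y \<in> PiE {1..m} C" using z k by (auto simp: C_def PiE_iff universe_def extensional_def)
  qed
  have "C i \<in> \<Lambda> i" if i: "i \<in> {1..m}" for i
  proof (cases "i = k")
    case True then show ?thesis using P i by (simp add: C_def)
  next
    case False
    obtain Q where Q: "Q \<in> \<Lambda> i" "z i \<in> Q" using universe_block[OF gp z i] by blast
    then show ?thesis using single[OF i False Q] i False by (simp add: C_def)
  qed
  then have "PiE {1..m} C \<in> boxes m \<Lambda>"
    by (auto simp: boxes_def minor_subproduct_def C_def)
  moreover have "z \<in> (\<lambda>v. z(k := v)) ` P" using P(2) by (metis fun_upd_triv imageI)
  moreover have "B = PiE {1..m} C" if B: "B \<in> boxes m \<Lambda>" "z \<in> B"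
  proof -
    obtain D where D: "D \<in> (\<Pi>\<^sub>E j\<in>{1..m}. \<Lambda> j)" "B = PiE {1..m} D"
      using B(1) unfolding boxes_def minor_subproduct_def by blast
    have "D i = C i" if i: "i \<in> {1..m}" for i
    proof -
      have Di: "D i \<in> \<Lambda> i" "z i \<in> D i" using D B(2) i by (auto simp: PiE_iff)
      show ?thesis
      proof (cases "i = k")
        case True
        have "disjoint (\<Lambda> k)" using part[OF k] by (simp add: partition_on_def)
        then have "D k = P" using Di P True by (metis disjointD IntI empty_iff)
        then show ?thesis using True i by (simp add: C_def)
      next
        case False then show ?thesis using single[OF i False Di] i by (simp add: C_def)
      qed
    qed
    then show ?thesis using D(2) PiE_cong[of "{1..m}" D C] by simp
  qed
  ultimately show ?thesis using img by metis
qed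

text \<open>The injection that sends \<open>v\<close> to \<open>z(k := v)\<close> carries the counts
  in the box over to the block \<open>P\<close>. The threshold depends on \<open>z k\<close> alone,
  and \<open>S\<close> enters only through its fibre over \<open>P\<close>, monotonically.\<close>

lemma mem_push_down:
  assumes gp: "generalized_partition m n \<Lambda>" and supp: "support m \<Lambda> = {k}"
    and z: "z \<in> universe m n" and P: "P \<in> \<Lambda> k" "z k \<in> P"
  shows "z \<in> push_down m S \<Lambda> \<longleftrightarrow> card {v\<in>P. v < z k} < card {v\<in>P. z(k := v) \<in> S}"
proof -
  let ?B = "(\<lambda>v. z(k := v)) ` P"
  have inj: "inj_on (\<lambda>v. z(k := v)) A" for A by (rule inj_onI) (metis fun_upd_same)
  have zB: "z \<in> ?B" using box_through[OF assms] by blast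
  have "z \<in> push_down m S \<Lambda> \<longleftrightarrow> (\<exists>B. (B \<in> boxes m \<Lambda> \<and> z \<in> B) \<and> card {y\<in>B. y k < z k} < card (S \<inter> B))"
    by (auto simp: push_down_def lowest_def supp)
  also have "\<dots> \<longleftrightarrow> card {y\<in>?B. y k < z k} < card (S \<inter> ?B)"
    unfolding box_through[OF assms] by blast
  also have "{y\<in>?B. y k < z k} = (\<lambda>v. z(k := v)) ` {v\<in>P. v < z k}" by auto
  also have "S \<inter> ?B = (\<lambda>v. z(k := v)) ` {v\<in>P. z(k := v) \<in> S}" by auto
  finally show ?thesis by (simp add: card_image[OF inj] del: fun_upd_apply)
qed

section \<open>Exchange is preserved by push downs and makes them commute\<close>

text \<open>The membership criterion is a monotone condition on fibres that fails on the empty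
  fibre, so \<open>exchangeable_fibrewise\<close> applies.\<close>

lemma exchangeable_push_down:
  assumes ex: "exchangeable m n S" and gp: "generalized_partition m n \<Lambda>"
    and one: "one_dimensional m \<Lambda>"
  shows "exchangeable m n (push_down m S \<Lambda>)"
proof -
  obtain k where k: "support m \<Lambda> = {k}"
    using one by (auto simp: one_dimensional_def is_singleton_def)
  have k': "k \<in> {1..m}" using k by (auto simp: support_def)
  define block where "block v = (SOME P. P \<in> \<Lambda> k \<and> v \<in> P)" for v
  \<comment> \<open>Monotonicity is required for all \<open>v\<close>, also those in no block, where
    \<open>SOME\<close> yields an unspecified set. The finiteness conjunct secures it there, since
    \<open>card\<close> is 0 on infinite sets.\<close>
  define f where "f v A \<longleftrightarrow> finite (block v) \<and> card {w\<in>block v. w < v} < card (block v \<inter> A)" for v A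
  show ?thesis
  proof (rule exchangeable_fibrewise[OF ex k', of f])
    show "f v B" if "f v A" "A \<subseteq> B" for v A B
      using that card_mono[of "block v \<inter> B" "block v \<inter> A"] by (fastforce simp: f_def)
    show "\<not> f v {}" for v by (simp add: f_def)
    fix z assume z: "z \<in> universe m n"
    have "\<exists>P. P \<in> \<Lambda> k \<and> z k \<in> P" using universe_block[OF gp z k'] by blast
    then have P: "block (z k) \<in> \<Lambda> k" "z k \<in> block (z k)"
      unfolding block_def by (metis (mono_tags, lifting) someI_ex)+
    have sub: "block (z k) \<subseteq> {..<n k}"
      by (rule block_subset[OF gp k' P(1)])
    then have fin: "finite (block (z k))" using finite_subset by blast
    have "{v\<in>block (z k). z(k := v) \<in> S} = block (z k) \<inter> {v\<in>{..<n k}. z(k := v) \<in> S}"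
      using sub by auto
    then show "z \<in> push_down m S \<Lambda> \<longleftrightarrow> f (z k) {v\<in>{..<n k}. z(k := v) \<in> S}"
      using mem_push_down[OF gp k z P] fin by (simp add: f_def)
  qed
qed

text \<open>
  \<open>N\<close> is a 0-1 matrix with nested rows; the two sides are the memberships in the two iterated push
  downs.
\<close>

lemma threshold_swap:
  fixes N :: "'a \<Rightarrow> 'b \<Rightarrow> bool"
  assumes fin: "finite P" "finite Q"
    and nested: "\<And>v v' w w'. \<lbrakk>v \<in> P; v' \<in> P; w \<in> Q; w' \<in> Q; N v w; N v' w'\<rbrakk> \<Longrightarrow> N v w' \<or> N v' w"
    and H: "b < card {w\<in>Q. a < card {v\<in>P. N v w}}"
  shows "a < card {v\<in>P. b < card {w\<in>Q. N v w}}"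
proof -
  let ?Q = "{w\<in>Q. a < card {v\<in>P. N v w}}"
  have "?Q \<noteq> {}" using H by (metis card.empty not_less_zero)
  \<comment> \<open>A smallest column among those counted in \<open>?Q\<close>. By nestedness it is
    contained in every other column of \<open>?Q\<close>.\<close>
  then obtain w where w: "w \<in> ?Q" "\<And>w'. w' \<in> ?Q \<Longrightarrow> card {v\<in>P. N v w} \<le> card {v\<in>P. N v w'}"
    using ex_has_least_nat[of "\<lambda>w. w \<in> ?Q" _ "\<lambda>w. card {v\<in>P. N v w}"] by blast
  have sub: "N v w'" if w': "w' \<in> ?Q" and v: "v \<in> P" "N v w" for v w'
  proof (rule ccontr)
    assume nv: "\<not> N v w'"
    have "{v\<in>P. N v w'} \<subset> {v\<in>P. N v w}"
      using nested[of v _ w w'] w(1) w' v nv by blast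
    then have "card {v\<in>P. N v w'} < card {v\<in>P. N v w}" using fin by (intro psubset_card_mono) auto
    then show False using w(2)[OF w'] by simp
  qed
  \<comment> \<open>A row meeting the smallest column meets all of \<open>?Q\<close>, which has more
    than \<open>b\<close> members; and more than \<open>a\<close> rows meet that column.\<close>
  have "b < card {w\<in>Q. N v w}" if "v \<in> P" "N v w" for v
  proof -
    have "?Q \<subseteq> {w\<in>Q. N v w}" using sub[OF _ that] by blast
    then have "card ?Q \<le> card {w\<in>Q. N v w}" using fin by (intro card_mono) auto
    then show ?thesis using H by simp
  qed
  then have "{v\<in>P. N v w} \<subseteq> {v\<in>P. b < card {w\<in>Q. N v w}}" by blast
  then have "card {v\<in>P. N v w} \<le> card {v\<in>P. b < card {w\<in>Q. N v w}}"
    using fin by (intro card_mono) auto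
  then show ?thesis using w(1) by simp
qed

text \<open>Exchange on a 2 by 2 grid: each of the two rows has an entry in \<open>S\<close>, so
  some column lies in \<open>S\<close> entirely, and each column contains one of the two corners in
  question.\<close>

lemma exchangeable_nested:
  assumes ex: "exchangeable m n S" and z: "z \<in> universe m n"
    and i: "i \<in> {1..m}" and j: "j \<in> {1..m}" and "i \<noteq> j"
    and v: "v < n i" "v' < n i" and w: "w < n j" "w' < n j"
    and S: "z(i := v, j := w) \<in> S" "z(i := v', j := w') \<in> S"
  shows "z(i := v, j := w') \<in> S \<or> z(i := v', j := w) \<in> S"
proof -
  define V where "V l = (if l = i then {v, v'} else if l = j then {w, w'} else {z l})" for l
  have form: "x = z(i := x i, j := x j)" if "x \<in> PiE {1..m} V" for x
  proof (rule ext)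
    fix l show "x l = (z(i := x i, j := x j)) l"
      using PiE_mem[OF that, of l] PiE_arb[OF that, of l] PiE_arb[OF z[unfolded universe_def], of l] i j
      by (cases "l \<in> {1..m}") (auto simp: V_def split: if_splits)
  qed
  have memV: "z(i := a, j := b) \<in> PiE {1..m} V" if "a \<in> {v, v'}" "b \<in> {w, w'}" for a b
    using that z i j \<open>i \<noteq> j\<close> by (auto simp: V_def PiE_iff universe_def extensional_def)
  have xV: "x i \<in> {v, v'}" "x j \<in> {w, w'}" if "x \<in> PiE {1..m} V" for x
    using PiE_mem[OF that i] PiE_mem[OF that j] \<open>i \<noteq> j\<close> by (auto simp: V_def)
  have ov: "override_on y x {i} = z(i := x i, j := y j)"
    if "y \<in> PiE {1..m} V" for x y
  proof -
    have "override_on y x {i} = y(i := x i)" by (auto simp: override_on_def)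
    also have "\<dots> = (z(i := y i, j := y j))(i := x i)" using form[OF that] by simp
    finally show ?thesis using \<open>i \<noteq> j\<close> by (simp add: fun_upd_twist)
  qed
  obtain y where y: "y \<in> PiE {1..m} V" "\<And>x. x \<in> PiE {1..m} V \<Longrightarrow> override_on y x {i} \<in> S"
  proof (rule exchangeableD[OF ex, of V "{i}"])
    show "V l \<noteq> {} \<and> V l \<subseteq> {..<n l}" if "l \<in> {1..m}" for l
      using that z v w by (auto simp: V_def universe_def)
    fix x assume x: "x \<in> PiE {1..m} V"
    obtain b where "b \<in> {w, w'}" "z(i := x i, j := b) \<in> S" using xV(1)[OF x] S by auto
    then show "\<exists>y\<in>PiE {1..m} V. override_on y x {i} \<in> S"
      using ov[OF memV[of v b]] memV[of v b] by (intro bexI[of _ "z(i := v, j := b)"]) auto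
  qed blast
  have "z(i := a, j := y j) \<in> S" if "a \<in> {v, v'}" for a
    using y(2)[OF memV[OF that, of w]] ov[OF y(1)] \<open>i \<noteq> j\<close> by simp
  then show ?thesis using xV(2)[OF y(1)] by auto
qed

text \<open>The second push down asks about the points \<open>z(j := w)\<close>, and for these the
  criterion of the first applies. As \<open>i\<close> and \<open>j\<close> differ, they share the
  \<open>i\<close>-th coordinate of \<open>z\<close>, so the inner threshold is the same for all
  \<open>w\<close>.\<close>

lemma mem_push_down_twice:
  assumes gp: "generalized_partition m n \<Lambda>" "generalized_partition m n \<Lambda>'"
    and supp: "support m \<Lambda> = {i}" "support m \<Lambda>' = {j}" and "i \<noteq> j"
    and z: "z \<in> universe m n" and P: "P \<in> \<Lambda> i" "z i \<in> P" and Q: "Q \<in> \<Lambda>' j" "z j \<in> Q"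
  shows "z \<in> push_down m (push_down m S \<Lambda>) \<Lambda>' \<longleftrightarrow>
    card {w\<in>Q. w < z j} < card {w\<in>Q. card {v\<in>P. v < z i} < card {v\<in>P. z(i := v, j := w) \<in> S}}"
proof -
  have j: "j \<in> {1..m}" using supp by (auto simp: support_def)
  have "z(j := w) \<in> push_down m S \<Lambda> \<longleftrightarrow> card {v\<in>P. v < z i} < card {v\<in>P. z(i := v, j := w) \<in> S}"
    if "w \<in> Q" for w
  proof -
    have "w < n j" using block_subset[OF gp(2) j Q(1)] that by auto
    then have "z(j := w) \<in> universe m n" using z j by (auto simp: universe_def PiE_iff extensional_def)
    then show ?thesis
      using mem_push_down[OF gp(1) supp(1), of "z(j := w)" P S] P \<open>i \<noteq> j\<close>
      by (simp add: fun_upd_twist)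
  qed
  then show ?thesis
    using mem_push_down[OF gp(2) supp(2) z Q] by (simp cong: conj_cong)
qed

text \<open>For a fixed \<open>z\<close> both orders are threshold conditions on the same matrix
  \<open>?N\<close>. It has nested rows by exchange, and \<open>threshold_swap\<close> is applied
  once to it and once with the two indices interchanged.\<close>

lemma push_down_commute:
  assumes ex: "exchangeable m n S"
    and gp: "generalized_partition m n \<Lambda>" "generalized_partition m n \<Lambda>'"
    and one: "one_dimensional m \<Lambda>" "one_dimensional m \<Lambda>'"
    and "support m \<Lambda> \<noteq> support m \<Lambda>'"
  shows "push_down m (push_down m S \<Lambda>) \<Lambda>' = push_down m (push_down m S \<Lambda>') \<Lambda>"
proof -
  obtain i j where supp: "support m \<Lambda> = {i}" "support m \<Lambda>' = {j}"
    using one by (auto simp: one_dimensional_def is_singleton_def)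
  have ij: "i \<in> {1..m}" "j \<in> {1..m}" "i \<noteq> j" using supp assms(6) by (auto simp: support_def)
  have "z \<in> push_down m (push_down m S \<Lambda>) \<Lambda>' \<longleftrightarrow> z \<in> push_down m (push_down m S \<Lambda>') \<Lambda>"
    if z: "z \<in> universe m n" for z
  proof -
    obtain P where P: "P \<in> \<Lambda> i" "z i \<in> P" "P \<subseteq> {..<n i}" using universe_block[OF gp(1) z ij(1)] .
    obtain Q where Q: "Q \<in> \<Lambda>' j" "z j \<in> Q" "Q \<subseteq> {..<n j}" using universe_block[OF gp(2) z ij(2)] .
    have fin: "finite P" "finite Q" using P Q finite_subset by blast+
    let ?N = "\<lambda>v w. z(i := v, j := w) \<in> S"
    let ?a = "card {v\<in>P. v < z i}" and ?b = "card {w\<in>Q. w < z j}"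
    have nested: "?N v w' \<or> ?N v' w"
      if "v \<in> P" "v' \<in> P" "w \<in> Q" "w' \<in> Q" "?N v w" "?N v' w'" for v v' w w'
      by (rule exchangeable_nested[OF ex z ij]) (use that P(3) Q(3) in auto)
    have "z \<in> push_down m (push_down m S \<Lambda>) \<Lambda>' \<longleftrightarrow> ?b < card {w\<in>Q. ?a < card {v\<in>P. ?N v w}}"
      by (rule mem_push_down_twice[OF gp supp ij(3) z P(1,2) Q(1,2)])
    also have "\<dots> \<longleftrightarrow> ?a < card {v\<in>P. ?b < card {w\<in>Q. ?N v w}}"
    proof
      assume "?b < card {w\<in>Q. ?a < card {v\<in>P. ?N v w}}"
      then show "?a < card {v\<in>P. ?b < card {w\<in>Q. ?N v w}}"
        by (rule threshold_swap[OF fin, rotated]) (use nested in blast)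
    next
      assume "?a < card {v\<in>P. ?b < card {w\<in>Q. ?N v w}}"
      then show "?b < card {w\<in>Q. ?a < card {v\<in>P. ?N v w}}"
        by (rule threshold_swap[OF fin(2,1), rotated]) (use nested in blast)
    qed
    also have "\<dots> \<longleftrightarrow> z \<in> push_down m (push_down m S \<Lambda>') \<Lambda>"
      using mem_push_down_twice[OF gp(2,1) supp(2,1) ij(3)[symmetric] z Q(1,2) P(1,2), of S]
        fun_upd_twist[OF ij(3), of z] by simp
    finally show ?thesis .
  qed
  then show ?thesis using push_down_subset_universe[OF gp(1)] push_down_subset_universe[OF gp(2)] by blast
qed

text \<open>Pairwise commutation holds only on exchangeable sets, but exchange survives each push
  down and hence serves as the invariant for permuting the fold.\<close>

lemma serial_push_down_permute:
  assumes ex: "exchangeable m n S"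
    and \<Lambda>s: "\<And>\<Lambda>. \<Lambda> \<in> set \<Lambda>s \<Longrightarrow> generalized_partition m n \<Lambda> \<and> one_dimensional m \<Lambda>"
    and dist: "distinct (map (support m) \<Lambda>s)" and mset: "mset \<Lambda>s = mset \<Lambda>s'"
  shows "serial_push_down m S \<Lambda>s = serial_push_down m S \<Lambda>s'"
proof -
  let ?g = "\<lambda>\<Lambda> T. push_down m T \<Lambda>"
  have "fold ?g \<Lambda>s S = fold ?g \<Lambda>s' S"
  proof (rule fold_permuted_eq[OF mset, where P = "exchangeable m n"])
    fix \<Lambda> \<Lambda>' T
    assume L: "\<Lambda> \<in> set \<Lambda>s" "\<Lambda>' \<in> set \<Lambda>s" and T: "exchangeable m n T"
    show "?g \<Lambda> (?g \<Lambda>' T) = ?g \<Lambda>' (?g \<Lambda> T)"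
    proof (cases "\<Lambda> = \<Lambda>'")
      case False
      then have "support m \<Lambda>' \<noteq> support m \<Lambda>" using dist L by (auto simp: distinct_map dest: inj_onD)
      then show ?thesis using L \<Lambda>s push_down_commute[OF T, of \<Lambda>' \<Lambda>] by simp
    qed simp
  qed (use ex \<Lambda>s exchangeable_push_down in auto)
  then show ?thesis by (simp add: serial_push_down_def foldl_conv_fold)
qed

section \<open>Ampleness and exchange\<close>

lemma shatteredD:
  assumes "shattered m \<Lambda> S" "\<And>i. i \<in> {1..m} \<Longrightarrow> C i \<in> \<Lambda> i"
  obtains x where "x \<in> PiE {1..m} C" "x \<in> S"
proof -
  have "restrict C {1..m} \<in> minor_subproduct m \<Lambda>"
    using assms(2) by (auto simp: minor_subproduct_def)
  then have "PiE {1..m} (restrict C {1..m}) \<in> boxes m \<Lambda>" by (auto simp: boxes_def)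
  moreover have "PiE {1..m} (restrict C {1..m}) = PiE {1..m} C" by (rule PiE_cong) simp
  ultimately show ?thesis using assms(1) that unfolding shattered_def by fastforce
qed

lemma shatteredI:
  assumes "\<And>C. (\<And>i. i \<in> {1..m} \<Longrightarrow> C i \<in> \<Lambda> i) \<Longrightarrow> \<exists>x\<in>PiE {1..m} C. x \<in> S"
  shows "shattered m \<Lambda> S"
  unfolding shattered_def
proof
  fix B assume "B \<in> boxes m \<Lambda>"
  then obtain C where "C \<in> (\<Pi>\<^sub>E i\<in>{1..m}. \<Lambda> i)" "B = PiE {1..m} C"
    by (auto simp: boxes_def minor_subproduct_def)
  then have "\<exists>x\<in>PiE {1..m} C. x \<in> S" by (intro assms) (rule PiE_mem)
  then show "S \<inter> B \<noteq> {}" using \<open>B = _\<close> by blast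
qed

lemma strongly_shatteredI:
  assumes "\<And>i. i \<in> {1..m} \<Longrightarrow> W i \<subseteq> \<Union>(\<Lambda> i)"
    and "\<And>i P. i \<in> {1..m} \<Longrightarrow> P \<in> \<Lambda> i \<Longrightarrow> is_singleton (W i \<inter> P)"
    and "PiE {1..m} W \<subseteq> S"
  shows "strongly_shattered m \<Lambda> S"
proof -
  have "\<forall>i\<in>{1..m}. W i \<subseteq> \<Union>(\<Lambda> i) \<and> (\<forall>P\<in>\<Lambda> i. is_singleton (W i \<inter> P))"
    using assms(1,2) by blast
  then have "PiE {1..m} W \<in> copies m \<Lambda>" unfolding copies_def by blast
  then show ?thesis using assms(3) unfolding strongly_shattered_def by blast
qed

lemma strongly_shatteredE:
  assumes "strongly_shattered m \<Lambda> S"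
  obtains W where "\<And>i. i \<in> {1..m} \<Longrightarrow> W i \<subseteq> \<Union>(\<Lambda> i)"
    and "\<And>i P. i \<in> {1..m} \<Longrightarrow> P \<in> \<Lambda> i \<Longrightarrow> is_singleton (W i \<inter> P)"
    and "PiE {1..m} W \<subseteq> S"
proof -
  obtain C where "C \<in> copies m \<Lambda>" "C \<subseteq> S" using assms unfolding strongly_shattered_def by blast
  then obtain W where "\<forall>i\<in>{1..m}. W i \<subseteq> \<Union>(\<Lambda> i) \<and> (\<forall>P\<in>\<Lambda> i. is_singleton (W i \<inter> P))"
    "PiE {1..m} W \<subseteq> S"
    unfolding copies_def by blast
  then show ?thesis by (intro that[of W]) blast+
qed

section \<open>From ampleness to exchange\<close>

lemma is_singleton_nonempty: "is_singleton A \<Longrightarrow> A \<noteq> {}"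
  by (auto simp: is_singleton_def)

lemma PiE_nonemptyE:
  assumes "\<And>i. i \<in> I \<Longrightarrow> A i \<noteq> {}"
  obtains x where "x \<in> PiE I A"
  using assms PiE_eq_empty_iff[of I A] by blast

text \<open>Generalized partitions of a nonempty subproduct. They occur in two inductions: one adds
  uncovered points until the factors are exhausted, the other shrinks blocks to singletons and
  thereby uncovers points.\<close>

definition partial_partition :: "nat \<Rightarrow> (nat \<Rightarrow> nat) \<Rightarrow> (nat \<Rightarrow> nat set set) \<Rightarrow> bool" where
  "partial_partition m n \<alpha> \<longleftrightarrow>
     (\<forall>i\<in>{1..m}. \<alpha> i \<noteq> {} \<and> {} \<notin> \<alpha> i \<and> \<Union>(\<alpha> i) \<subseteq> {..<n i} \<and> disjoint (\<alpha> i))"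

lemma partial_partitionD:
  assumes "partial_partition m n \<alpha>" "i \<in> {1..m}"
  shows "\<alpha> i \<noteq> {}" "{} \<notin> \<alpha> i" "\<Union>(\<alpha> i) \<subseteq> {..<n i}" "disjoint (\<alpha> i)"
  using assms by (simp_all add: partial_partition_def)

lemma partial_partition_upd:
  assumes "partial_partition m n \<alpha>"
    and "A \<noteq> {}" "{} \<notin> A" "\<Union>A \<subseteq> {..<n k}" "disjoint A"
  shows "partial_partition m n (\<alpha>(k := A))"
  using assms by (simp add: partial_partition_def)

text \<open>Induction on the number of uncovered points. When none is left, \<open>\<alpha>\<close>
  is a generalized partition and ampleness applies directly.\<close>

lemma ample_partial_partition:
  assumes ample: "ample m n S" and "partial_partition m n \<alpha>" "shattered m \<alpha> S"
  shows "strongly_shattered m \<alpha> S"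
  using assms(2,3)
proof (induction "\<Sum>i\<in>{1..m}. card ({..<n i} - \<Union>(\<alpha> i))" arbitrary: \<alpha> rule: less_induct)
  case less
  note pp = partial_partitionD[OF less.prems(1)]
  show ?case
  proof (cases "\<forall>i\<in>{1..m}. \<Union>(\<alpha> i) = {..<n i}")
    case True
    then have "generalized_partition m n \<alpha>"
      using pp by (auto simp: generalized_partition_def partition_on_def)
    then show ?thesis using ample less.prems(2) by (auto simp: ample_def)
  next
    case False
    then obtain k u where k: "k \<in> {1..m}" and u: "u < n k" "u \<notin> \<Union>(\<alpha> k)"
      using pp(3) by blast
    obtain P where P: "P \<in> \<alpha> k" using pp(1)[OF k] by blast
    have smaller: "(\<Sum>i\<in>{1..m}. card ({..<n i} - \<Union>((\<alpha>(k := A)) i))) < (\<Sum>i\<in>{1..m}. card ({..<n i} - \<Union>(\<alpha> i)))"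
      if "\<Union>A = insert u (\<Union>(\<alpha> k))" for A
    proof (rule sum_strict_mono_ex1)
      have "card ({..<n k} - insert u (\<Union>(\<alpha> k))) < card ({..<n k} - \<Union>(\<alpha> k))"
        using u by (intro psubset_card_mono) auto
      then show "\<exists>i\<in>{1..m}. card ({..<n i} - \<Union>((\<alpha>(k := A)) i)) < card ({..<n i} - \<Union>(\<alpha> i))"
        using k that by (intro bexI[of _ k]) auto
      show "\<forall>i\<in>{1..m}. card ({..<n i} - \<Union>((\<alpha>(k := A)) i)) \<le> card ({..<n i} - \<Union>(\<alpha> i))"
        using that by (auto intro!: card_mono)
    qed simp
    \<comment> \<open>Attach \<open>u\<close> to \<open>P\<close>. If the resulting copy uses \<open>u\<close>, then the level \<open>u\<close> shatters the rest, so
      \<open>{u}\<close> can be added as a block of its own and dropped from the copy obtained then.\<close>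
    define A where "A = insert (insert u P) (\<alpha> k - {P})"
    have UA: "\<Union>A = insert u (\<Union>(\<alpha> k))" using P by (auto simp: A_def)
    have "disjoint A"
      using pp(4)[OF k] u(2) P unfolding A_def disjoint_def by blast
    then have ppA: "partial_partition m n (\<alpha>(k := A))"
      using pp[OF k] u UA P by (intro partial_partition_upd[OF less.prems(1)]) (auto simp: A_def)
    have "shattered m (\<alpha>(k := A)) S"
    proof (rule shatteredI)
      fix C assume C: "\<And>i. i \<in> {1..m} \<Longrightarrow> C i \<in> (\<alpha>(k := A)) i"
      \<comment> \<open>Trading the enlarged block back for \<open>P\<close> gives a smaller box
        that belongs to \<open>\<alpha>\<close>, so it already contains a point of
        \<open>S\<close>.\<close>
      define D where "D = C(k := if C k = insert u P then P else C k)"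
      have "D i \<in> \<alpha> i" if "i \<in> {1..m}" for i
        using C[OF that] P by (auto simp: D_def A_def split: if_splits)
      then obtain x where x: "x \<in> PiE {1..m} D" "x \<in> S" using shatteredD[OF less.prems(2)] by blast
      have "PiE {1..m} D \<subseteq> PiE {1..m} C" by (rule PiE_mono) (auto simp: D_def)
      then show "\<exists>x\<in>PiE {1..m} C. x \<in> S" using x by blast
    qed
    then have "strongly_shattered m (\<alpha>(k := A)) S" by (rule less.hyps[OF smaller[OF UA] ppA])
    then obtain W where W: "\<And>i. i \<in> {1..m} \<Longrightarrow> W i \<subseteq> \<Union>((\<alpha>(k := A)) i)"
      "\<And>i P. i \<in> {1..m} \<Longrightarrow> P \<in> (\<alpha>(k := A)) i \<Longrightarrow> is_singleton (W i \<inter> P)" "PiE {1..m} W \<subseteq> S"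
      by (rule strongly_shatteredE) (rule that)
    show ?thesis
    proof (cases "u \<in> W k")
      case False
      show ?thesis
      proof (rule strongly_shatteredI[of m W])
        show "W i \<subseteq> \<Union>(\<alpha> i)" if "i \<in> {1..m}" for i
          using W(1)[OF that] False UA by (auto split: if_splits)
        show "is_singleton (W i \<inter> Q)" if "i \<in> {1..m}" "Q \<in> \<alpha> i" for i Q
        proof (cases "i = k \<and> Q = P")
          case True
          then have "is_singleton (W i \<inter> insert u Q)" using W(2)[OF k, of "insert u P"] by (simp add: A_def)
          then show ?thesis using False True by simp
        next
          case False
          then have "Q \<in> (\<alpha>(k := A)) i" using that(2) by (auto simp: A_def)
          then show ?thesis by (rule W(2)[OF that(1)])
        qed
      qed (rule W(3))
    next
      case True
      define A' where "A' = insert {u} (\<alpha> k)"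
      have UA': "\<Union>A' = insert u (\<Union>(\<alpha> k))" by (auto simp: A'_def)
      have "disjoint A'"
        using pp(4)[OF k] u(2) unfolding A'_def disjoint_def by blast
      then have ppA': "partial_partition m n (\<alpha>(k := A'))"
        using pp[OF k] u UA' by (intro partial_partition_upd[OF less.prems(1)]) (auto simp: A'_def)
      have "shattered m (\<alpha>(k := A')) S"
      proof (rule shatteredI)
        fix C assume C: "\<And>i. i \<in> {1..m} \<Longrightarrow> C i \<in> (\<alpha>(k := A')) i"
        show "\<exists>x\<in>PiE {1..m} C. x \<in> S"
        proof (cases "C k = {u}")
          case True
          \<comment> \<open>The copy \<open>W\<close> has a point in each box at level
            \<open>u\<close>, which can be picked coordinate by coordinate.\<close>
          have "W i \<inter> C i \<noteq> {}" if i: "i \<in> {1..m}" for i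
          proof (cases "i = k")
            case True then show ?thesis using \<open>u \<in> W k\<close> \<open>C k = {u}\<close> by simp
          next
            case False then show ?thesis using W(2)[OF i, of "C i"] C[OF i] by (auto dest: is_singleton_nonempty)
          qed
          then obtain x where "x \<in> PiE {1..m} (\<lambda>i. W i \<inter> C i)" by (rule PiE_nonemptyE)
          then have "x \<in> PiE {1..m} W" "x \<in> PiE {1..m} C" by (auto simp: PiE_iff)
          then show ?thesis using W(3) by blast
        next
          case False
          have "C i \<in> \<alpha> i" if "i \<in> {1..m}" for i
            using C[OF that] False by (auto simp: A'_def split: if_splits)
          then show ?thesis using shatteredD[OF less.prems(2)] by blast
        qed
      qed
      then have "strongly_shattered m (\<alpha>(k := A')) S" by (rule less.hyps[OF smaller[OF UA'] ppA'])
      then obtain W' where W': "\<And>i. i \<in> {1..m} \<Longrightarrow> W' i \<subseteq> \<Union>((\<alpha>(k := A')) i)"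
        "\<And>i P. i \<in> {1..m} \<Longrightarrow> P \<in> (\<alpha>(k := A')) i \<Longrightarrow> is_singleton (W' i \<inter> P)" "PiE {1..m} W' \<subseteq> S"
        by (rule strongly_shatteredE) (rule that)
      show ?thesis
      proof (rule strongly_shatteredI[of m "W'(k := W' k - {u})"])
        show "(W'(k := W' k - {u})) i \<subseteq> \<Union>(\<alpha> i)" if "i \<in> {1..m}" for i
          using W'(1)[OF that] UA' by (auto split: if_splits)
        show "is_singleton ((W'(k := W' k - {u})) i \<inter> Q)" if "i \<in> {1..m}" "Q \<in> \<alpha> i" for i Q
        proof -
          have "(W'(k := W' k - {u})) i \<inter> Q = W' i \<inter> Q" using that u(2) by auto
          moreover have "Q \<in> (\<alpha>(k := A')) i" using that(2) by (auto simp: A'_def)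
          ultimately show ?thesis using W'(2)[OF that(1), of Q] by metis
        qed
        have "PiE {1..m} (W'(k := W' k - {u})) \<subseteq> PiE {1..m} W'" by (rule PiE_mono) auto
        then show "PiE {1..m} (W'(k := W' k - {u})) \<subseteq> S" using W'(3) by blast
      qed
    qed
  qed
qed

text \<open>For the partition \<open>\<alpha>\<close> chosen here, being shattered follows from the
  forall-exists hypothesis. A copy contains all of \<open>V i\<close> for \<open>i\<close> in
  \<open>X\<close>, so any tuple \<open>y\<close> of the copy is a witness for
  exists-forall.\<close>

lemma ample_imp_exchangeable:
  assumes "ample m n S"
  shows "exchangeable m n S"
  unfolding exchangeable_def
proof (intro allI impI)
  fix V X
  assume V: "\<forall>i\<in>{1..m}. V i \<noteq> {} \<and> V i \<subseteq> {..<n i}"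
    and H: "\<forall>x\<in>PiE {1..m} V. \<exists>y\<in>PiE {1..m} V. override_on y x X \<in> S"
  define \<alpha> where "\<alpha> i = (if i \<in> X then (\<lambda>v. {v}) ` V i else {V i})" for i
  have U: "\<Union>(\<alpha> i) = V i" for i by (simp add: \<alpha>_def)
  have "partial_partition m n \<alpha>"
    using V U by (auto simp: partial_partition_def \<alpha>_def disjoint_def)
  moreover have "shattered m \<alpha> S"
  proof (rule shatteredI)
    fix C assume C: "\<And>i. i \<in> {1..m} \<Longrightarrow> C i \<in> \<alpha> i"
    have "C i \<noteq> {}" if "i \<in> {1..m}" for i using C[OF that] V that by (auto simp: \<alpha>_def split: if_splits)
    then obtain x where x: "x \<in> PiE {1..m} C" by (rule PiE_nonemptyE)
    have "PiE {1..m} C \<subseteq> PiE {1..m} V" by (rule PiE_mono) (use C U in blast)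
    then obtain y where y: "y \<in> PiE {1..m} V" "override_on y x X \<in> S" using H x by blast
    have "override_on y x X i \<in> C i" if i: "i \<in> {1..m}" for i
      using C[OF i] PiE_mem[OF x i] PiE_mem[OF y(1) i] by (auto simp: \<alpha>_def override_on_def split: if_splits)
    then have "override_on y x X \<in> PiE {1..m} C"
      using x y(1) by (auto simp: PiE_iff extensional_def override_on_def)
    then show "\<exists>x\<in>PiE {1..m} C. x \<in> S" using y(2) by blast
  qed
  ultimately have "strongly_shattered m \<alpha> S" by (rule ample_partial_partition[OF assms])
  then obtain W where W: "\<And>i. i \<in> {1..m} \<Longrightarrow> W i \<subseteq> \<Union>(\<alpha> i)"
      "\<And>i P. i \<in> {1..m} \<Longrightarrow> P \<in> \<alpha> i \<Longrightarrow> is_singleton (W i \<inter> P)" "PiE {1..m} W \<subseteq> S"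
    by (rule strongly_shatteredE) (rule that)
  have "W i \<noteq> {}" if "i \<in> {1..m}" for i
  proof -
    have "\<alpha> i \<noteq> {}" using V that by (simp add: \<alpha>_def)
    then obtain P where "P \<in> \<alpha> i" by blast
    then show ?thesis using is_singleton_nonempty[OF W(2)[OF that]] by blast
  qed
  then obtain y where y: "y \<in> PiE {1..m} W" by (rule PiE_nonemptyE)
  have "v \<in> W i" if "i \<in> {1..m}" "i \<in> X" "v \<in> V i" for i v
    using is_singleton_nonempty[OF W(2)[OF that(1), of "{v}"]] that(2,3) by (simp add: \<alpha>_def)
  then have "override_on y x X \<in> PiE {1..m} W" if "x \<in> PiE {1..m} V" for x
    using that y by (auto simp: PiE_iff extensional_def override_on_def)
  then have "\<forall>x\<in>PiE {1..m} V. override_on y x X \<in> S" using W(3) by blast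
  moreover have "PiE {1..m} W \<subseteq> PiE {1..m} V" by (rule PiE_mono) (use W(1) U in blast)
  then have "y \<in> PiE {1..m} V" using y by blast
  ultimately show "\<exists>y\<in>PiE {1..m} V. \<forall>x\<in>PiE {1..m} V. override_on y x X \<in> S" by (rule bexI)
qed

section \<open>From exchange to ampleness\<close>

lemma support_upd_psubset:
  assumes "k \<in> support m \<alpha>" "\<And>P. P \<in> A \<Longrightarrow> is_singleton P"
  shows "support m (\<alpha>(k := A)) \<subset> support m \<alpha>"
  using assms by (auto simp: support_def)

text \<open>Exchange with \<open>k\<close> as the only existential coordinate, ranging over
  \<open>P\<close>. The point \<open>w\<close> of \<open>W k\<close> is a placeholder that turns
  tuples of \<open>W(k := P)\<close> into tuples of \<open>W\<close>.\<close>

lemma exchangeable_common_level: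
  assumes ex: "exchangeable m n S" and k: "k \<in> {1..m}" and P: "P \<noteq> {}" "P \<subseteq> {..<n k}"
    and W: "\<And>i. i \<in> {1..m} \<Longrightarrow> W i \<noteq> {} \<and> W i \<subseteq> {..<n i}"
    and H: "\<And>x. x \<in> PiE {1..m} W \<Longrightarrow> \<exists>u\<in>P. x(k := u) \<in> S"
  shows "\<exists>u\<in>P. \<forall>x\<in>PiE {1..m} W. x(k := u) \<in> S"
proof -
  obtain w where w: "w \<in> W k" using W[OF k] by blast
  have ov: "override_on y x ({1..m} - {k}) = x(k := y k)"
    if "x \<in> PiE {1..m} A" "y \<in> PiE {1..m} B" for x y :: "nat \<Rightarrow> nat" and A B
    using that by (auto simp: PiE_iff extensional_def override_on_def fun_eq_iff)
  obtain y where y: "y \<in> PiE {1..m} (W(k := P))"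
    "\<And>x. x \<in> PiE {1..m} (W(k := P)) \<Longrightarrow> override_on y x ({1..m} - {k}) \<in> S"
  proof (rule exchangeableD[OF ex, of "W(k := P)" "{1..m} - {k}"])
    show "(W(k := P)) i \<noteq> {} \<and> (W(k := P)) i \<subseteq> {..<n i}" if "i \<in> {1..m}" for i
      using W[OF that] P by simp
    fix x assume x: "x \<in> PiE {1..m} (W(k := P))"
    obtain u where u: "u \<in> P" "x(k := u) \<in> S"
      using H[OF fun_upd_in_PiE'[OF x k w]] by auto
    have "x(k := u) \<in> PiE {1..m} (W(k := P))" using fun_upd_in_PiE[OF x k u(1)] by simp
    then show "\<exists>y\<in>PiE {1..m} (W(k := P)). override_on y x ({1..m} - {k}) \<in> S"
      using ov[OF x, of "x(k := u)"] u(2) by (intro bexI[of _ "x(k := u)"]) auto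
  qed blast
  have yk: "y k \<in> P" using PiE_mem[OF y(1) k] by simp
  have "x(k := y k) \<in> S" if "x \<in> PiE {1..m} W" for x
    using y(2)[OF fun_upd_in_PiE[OF that k yk]] ov[OF fun_upd_in_PiE[OF that k yk] y(1)] by simp
  then show ?thesis using yk by blast
qed

text \<open>Induction on the number of coordinates with a non-singleton block. Within one such
  coordinate \<open>k\<close>, each block \<open>P\<close> is replaced by a single level
  \<open>u P\<close> so that \<open>S\<close> still shatters the result; a copy of the result is
  then also a copy of \<open>\<alpha>\<close>.\<close>

lemma exchangeable_strongly_shattered:
  assumes "exchangeable m n S" "partial_partition m n \<alpha>" "shattered m \<alpha> S"
  shows "strongly_shattered m \<alpha> S"
  using assms
proof (induction "card (support m \<alpha>)" arbitrary: \<alpha> S rule: less_induct)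
  case less
  note pp = partial_partitionD[OF less.prems(2)]
  have fin: "finite (support m \<alpha>)" by (simp add: support_def)
  show ?case
  proof (cases "support m \<alpha> = {}")
    case True
    then have single: "is_singleton P" if "i \<in> {1..m}" "P \<in> \<alpha> i" for i P
      using that by (auto simp: support_def)
    \<comment> \<open>All boxes are single points, so shattering puts the whole product into
      \<open>S\<close>.\<close>
    show ?thesis
    proof (rule strongly_shatteredI[of m "\<lambda>i. \<Union>(\<alpha> i)"])
      show "is_singleton (\<Union>(\<alpha> i) \<inter> P)" if "i \<in> {1..m}" "P \<in> \<alpha> i" for i P
        using single[OF that] that(2) by (metis Sup_upper inf.absorb2)
      show "PiE {1..m} (\<lambda>i. \<Union>(\<alpha> i)) \<subseteq> S"
      proof
        fix x assume x: "x \<in> PiE {1..m} (\<lambda>i. \<Union>(\<alpha> i))"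
        have "{x i} \<in> \<alpha> i" if i: "i \<in> {1..m}" for i
          using PiE_mem[OF x i] single[OF i] by (fastforce simp: is_singleton_def)
        then obtain y where y: "y \<in> PiE {1..m} (\<lambda>i. {x i})" "y \<in> S"
          using shatteredD[OF less.prems(3), of "\<lambda>i. {x i}"] by blast
        have "y i = x i" for i
          using PiE_mem[OF y(1), of i] PiE_arb[OF y(1), of i] PiE_arb[OF x, of i]
          by (cases "i \<in> {1..m}") auto
        then have "y = x" by blast
        then show "x \<in> S" using y(2) by simp
      qed
    qed simp
  next
    case False
    then obtain k where ks: "k \<in> support m \<alpha>" by blast
    then have k: "k \<in> {1..m}" by (simp add: support_def)
    have smaller: "card (support m (\<alpha>(k := A))) < card (support m \<alpha>)" if "\<And>P. P \<in> A \<Longrightarrow> is_singleton P" for A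
      using psubset_card_mono[OF fin support_upd_psubset[OF ks that]] by simp
    \<comment> \<open>Induction on the projection \<open>T\<close> of the slab over \<open>P\<close> gives a copy in the other coordinates;
      by exchange it lies over a single level \<open>u\<close>, so \<open>P\<close> may be replaced by \<open>{u}\<close>.\<close>
    have "\<exists>u\<in>P. \<exists>W. (\<forall>i\<in>{1..m}. \<forall>Q\<in>\<alpha> i. i \<noteq> k \<longrightarrow> W i \<inter> Q \<noteq> {}) \<and> W k \<noteq> {} \<and>
        (\<forall>x\<in>PiE {1..m} W. x(k := u) \<in> S)" if P: "P \<in> \<alpha> k" for P
    proof -
      have Pn: "P \<noteq> {}" "P \<subseteq> {..<n k}" using pp(2,3)[OF k] P by auto
      then obtain p where p: "p \<in> P" by blast
      define T where "T = {z. \<exists>u\<in>P. z(k := u) \<in> S}"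
      have exT: "exchangeable m n T"
      proof (rule exchangeable_fibrewise[OF less.prems(1) k, of "\<lambda>_ A. A \<inter> P \<noteq> {}"])
        show "z \<in> T \<longleftrightarrow> {v \<in> {..<n k}. z(k := v) \<in> S} \<inter> P \<noteq> {}" for z
          using Pn(2) by (auto simp: T_def)
      qed auto
      \<comment> \<open>Membership in \<open>T\<close> ignores the coordinate \<open>k\<close>, so a
        single level \<open>p\<close> represents it; the block \<open>{p}\<close> also removes
        \<open>k\<close> from the support.\<close>
      have ppT: "partial_partition m n (\<alpha>(k := {{p}}))"
        using p Pn(2) by (intro partial_partition_upd[OF less.prems(2)]) (auto simp: disjoint_def)
      have "shattered m (\<alpha>(k := {{p}})) T"
      proof (rule shatteredI)
        fix C assume C: "\<And>i. i \<in> {1..m} \<Longrightarrow> C i \<in> (\<alpha>(k := {{p}})) i"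
        have "(C(k := P)) i \<in> \<alpha> i" if "i \<in> {1..m}" for i
          using C[OF that] P by (auto split: if_splits)
        then obtain x where x: "x \<in> PiE {1..m} (C(k := P))" "x \<in> S" using shatteredD[OF less.prems(3)] by blast
        have "x(k := p) \<in> PiE {1..m} C" using fun_upd_in_PiE'[OF x(1) k, of p] C[OF k] by simp
        moreover have "x(k := p) \<in> T" using PiE_mem[OF x(1) k] x(2) by (auto simp: T_def intro: bexI[of _ "x k"])
        ultimately show "\<exists>x\<in>PiE {1..m} C. x \<in> T" by blast
      qed
      moreover have "card (support m (\<alpha>(k := {{p}}))) < card (support m \<alpha>)"
        by (rule smaller) (simp add: is_singleton_def)
      ultimately have "strongly_shattered m (\<alpha>(k := {{p}})) T" by (intro less.hyps[OF _ exT ppT])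
      then obtain W where W: "\<And>i. i \<in> {1..m} \<Longrightarrow> W i \<subseteq> \<Union>((\<alpha>(k := {{p}})) i)"
        "\<And>i Q. i \<in> {1..m} \<Longrightarrow> Q \<in> (\<alpha>(k := {{p}})) i \<Longrightarrow> is_singleton (W i \<inter> Q)" "PiE {1..m} W \<subseteq> T"
        by (rule strongly_shatteredE) (rule that)
      have meets: "W i \<inter> Q \<noteq> {}" if "i \<in> {1..m}" "Q \<in> (\<alpha>(k := {{p}})) i" for i Q
        using is_singleton_nonempty[OF W(2)[OF that]] .
      have Wn: "W i \<noteq> {} \<and> W i \<subseteq> {..<n i}" if i: "i \<in> {1..m}" for i
        using meets[OF i] W(1)[OF i] partial_partitionD[OF ppT i] by blast
      have "\<exists>u\<in>P. \<forall>x\<in>PiE {1..m} W. x(k := u) \<in> S"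
        by (rule exchangeable_common_level[OF less.prems(1) k Pn Wn]) (use W(3) in \<open>auto simp: T_def\<close>)
      moreover have "W i \<inter> Q \<noteq> {}" if "i \<in> {1..m}" "Q \<in> \<alpha> i" "i \<noteq> k" for i Q
        using meets[OF that(1)] that by simp
      ultimately show ?thesis using Wn[OF k] by blast
    qed
    then obtain u where u: "\<And>P. P \<in> \<alpha> k \<Longrightarrow> u P \<in> P"
      and uW: "\<And>P. P \<in> \<alpha> k \<Longrightarrow> \<exists>W. (\<forall>i\<in>{1..m}. \<forall>Q\<in>\<alpha> i. i \<noteq> k \<longrightarrow> W i \<inter> Q \<noteq> {}) \<and> W k \<noteq> {} \<and>
        (\<forall>x\<in>PiE {1..m} W. x(k := u P) \<in> S)"
      by metis
    define A where "A = (\<lambda>P. {u P}) ` \<alpha> k"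
    have UA: "\<Union>A = u ` \<alpha> k" by (auto simp: A_def)
    have ppA: "partial_partition m n (\<alpha>(k := A))"
      using pp(1,3)[OF k] u by (intro partial_partition_upd[OF less.prems(2)]) (auto simp: A_def disjoint_def)
    have "shattered m (\<alpha>(k := A)) S"
    proof (rule shatteredI)
      fix C assume C: "\<And>i. i \<in> {1..m} \<Longrightarrow> C i \<in> (\<alpha>(k := A)) i"
      then obtain P where P: "P \<in> \<alpha> k" "C k = {u P}" using k by (fastforce simp: A_def)
      obtain W where W: "\<And>i Q. i \<in> {1..m} \<Longrightarrow> Q \<in> \<alpha> i \<Longrightarrow> i \<noteq> k \<Longrightarrow> W i \<inter> Q \<noteq> {}" "W k \<noteq> {}"
        "\<And>x. x \<in> PiE {1..m} W \<Longrightarrow> x(k := u P) \<in> S" using uW[OF P(1)] by blast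
      \<comment> \<open>Off \<open>k\<close> the point is taken from the copy inside the box. At
        \<open>k\<close> any element of \<open>W k\<close> will do, since it is overwritten by
        \<open>u P\<close>.\<close>
      have "(if i = k then W i else W i \<inter> C i) \<noteq> {}" if "i \<in> {1..m}" for i
        using W(1)[OF that, of "C i"] W(2) C[OF that] by auto
      then obtain x where x: "x \<in> PiE {1..m} (\<lambda>i. if i = k then W i else W i \<inter> C i)" by (rule PiE_nonemptyE)
      have "(\<Pi>\<^sub>E i\<in>{1..m}. if i = k then W i else W i \<inter> C i) \<subseteq> PiE {1..m} W" by (rule PiE_mono) auto
      then have "x \<in> PiE {1..m} W" using x by blast
      then have "x(k := u P) \<in> S" by (rule W(3))
      moreover have "x(k := u P) \<in> PiE {1..m} C"
        using x k P(2) by (auto simp: PiE_iff extensional_def)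
      ultimately show "\<exists>x\<in>PiE {1..m} C. x \<in> S" by blast
    qed
    moreover have "card (support m (\<alpha>(k := A))) < card (support m \<alpha>)"
      by (rule smaller) (auto simp: A_def is_singleton_def)
    ultimately have "strongly_shattered m (\<alpha>(k := A)) S" by (intro less.hyps[OF _ less.prems(1) ppA])
    then obtain W where W: "\<And>i. i \<in> {1..m} \<Longrightarrow> W i \<subseteq> \<Union>((\<alpha>(k := A)) i)"
      "\<And>i Q. i \<in> {1..m} \<Longrightarrow> Q \<in> (\<alpha>(k := A)) i \<Longrightarrow> is_singleton (W i \<inter> Q)" "PiE {1..m} W \<subseteq> S"
      by (rule strongly_shatteredE) (rule that)
    have Wk: "W k \<subseteq> u ` \<alpha> k" using W(1)[OF k] UA by simp
    have "u ` \<alpha> k \<subseteq> \<Union>(\<alpha> k)" using u by auto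
    then have "W k \<subseteq> \<Union>(\<alpha> k)" using Wk by blast
    show ?thesis
    proof (rule strongly_shatteredI[of m W])
      show "W i \<subseteq> \<Union>(\<alpha> i)" if "i \<in> {1..m}" for i
        using W(1)[OF that] \<open>W k \<subseteq> \<Union>(\<alpha> k)\<close> by (cases "i = k") simp_all
      show "is_singleton (W i \<inter> P)" if i: "i \<in> {1..m}" and P: "P \<in> \<alpha> i" for i P
      proof (cases "i = k")
        case True
        have "is_singleton (W k \<inter> {u P})" using W(2)[OF k, of "{u P}"] P True by (simp add: A_def)
        then have "W k \<inter> {u P} \<noteq> {}" by (rule is_singleton_nonempty)
        then have "u P \<in> W k" by simp
        \<comment> \<open>Elements of \<open>W k\<close> have the form \<open>u Q\<close> with
          \<open>u Q\<close> in \<open>Q\<close>, so disjointness of the blocks leaves only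
          \<open>u P\<close> inside \<open>P\<close>.\<close>
        moreover have "x = u P" if x: "x \<in> W k" "x \<in> P" for x
        proof -
          obtain Q where Q: "Q \<in> \<alpha> k" "x = u Q" using Wk x(1) by blast
          then have "x \<in> Q \<inter> P" using u[OF Q(1)] x(2) by simp
          then have "Q = P" using disjointD[OF pp(4)[OF k] Q(1), of P] P True by blast
          then show ?thesis using Q(2) by simp
        qed
        moreover have "u P \<in> P" using u P True by simp
        ultimately have "W k \<inter> P = {u P}" by blast
        then show ?thesis using True by (simp add: is_singleton_def)
      next
        case False then show ?thesis using W(2)[OF i, of P] P by simp
      qed
    qed (rule W(3))
  qed
qed

lemma exchangeable_imp_ample:
  assumes "exchangeable m n S" "\<forall>i\<in>{1..m}. 0 < n i"
  shows "ample m n S"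
  unfolding ample_def
proof (intro allI impI)
  fix \<Lambda> assume gp: "generalized_partition m n \<Lambda>" and sh: "shattered m \<Lambda> S"
  \<comment> \<open>Since \<open>0 < n i\<close>, a partition of \<open>{..<n i}\<close> has at
    least one block.\<close>
  have "partial_partition m n \<Lambda>"
    using gp assms(2) by (fastforce simp: generalized_partition_def partition_on_def partial_partition_def)
  then show "strongly_shattered m \<Lambda> S" by (rule exchangeable_strongly_shattered[OF assms(1) _ sh])
qed

section \<open>Push downs as quantifiers\<close>

text \<open>A push down along this partition acts only inside \<open>A\<close>: every other level is
  a block of its own, on which nothing moves.\<close>

definition block_partition :: "(nat \<Rightarrow> nat) \<Rightarrow> nat \<Rightarrow> nat set \<Rightarrow> nat \<Rightarrow> nat set set" where
  "block_partition n k A i =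
     (if i = k then insert A ((\<lambda>v. {v}) ` ({..<n i} - A)) else (\<lambda>v. {v}) ` {..<n i})"

lemma generalized_partition_block_partition:
  assumes "A \<noteq> {}" "A \<subseteq> {..<n k}"
  shows "generalized_partition m n (block_partition n k A)"
  using assms by (auto simp: generalized_partition_def partition_on_def block_partition_def disjoint_def)

lemma support_block_partition:
  assumes "k \<in> {1..m}" "\<not> is_singleton A"
  shows "support m (block_partition n k A) = {k}"
  using assms by (auto simp: support_def block_partition_def is_singleton_def split: if_splits)

text \<open>No element of \<open>A\<close> precedes its minimum, so the threshold is 0 and one point
  of the fibre suffices.\<close>

lemma push_down_block_Min:
  assumes k: "k \<in> {1..m}" and A: "A \<noteq> {}" "A \<subseteq> {..<n k}" "\<not> is_singleton A"
    and z: "z \<in> universe m n" "z k = Min A"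
  shows "z \<in> push_down m S (block_partition n k A) \<longleftrightarrow> (\<exists>v\<in>A. z(k := v) \<in> S)"
proof -
  have fin: "finite A" using A(2) finite_subset by blast
  have "z \<in> push_down m S (block_partition n k A) \<longleftrightarrow> card {v\<in>A. v < z k} < card {v\<in>A. z(k := v) \<in> S}"
    by (rule mem_push_down[OF generalized_partition_block_partition[of A n k m, OF A(1,2)] support_block_partition[OF k A(3)] z(1)])
      (use z(2) fin A(1) in \<open>auto simp: block_partition_def\<close>)
  also have "{v\<in>A. v < z k} = {}" using z(2) fin by (auto simp: not_less)
  also have "card {} < card {v\<in>A. z(k := v) \<in> S} \<longleftrightarrow> {v\<in>A. z(k := v) \<in> S} \<noteq> {}"
    using fin card_gt_0_iff[of "{v\<in>A. z(k := v) \<in> S}"] by simp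
  finally show ?thesis by blast
qed

text \<open>All elements of \<open>A\<close> but one precede its maximum, so the count must exceed
  \<open>card A - 1\<close> and the whole fibre is needed.\<close>

lemma push_down_block_Max:
  assumes k: "k \<in> {1..m}" and A: "A \<noteq> {}" "A \<subseteq> {..<n k}" "\<not> is_singleton A"
    and z: "z \<in> universe m n" "z k = Max A"
  shows "z \<in> push_down m S (block_partition n k A) \<longleftrightarrow> (\<forall>v\<in>A. z(k := v) \<in> S)"
proof -
  have fin: "finite A" using A(2) finite_subset by blast
  have "z \<in> push_down m S (block_partition n k A) \<longleftrightarrow> card {v\<in>A. v < z k} < card {v\<in>A. z(k := v) \<in> S}"
    by (rule mem_push_down[OF generalized_partition_block_partition[of A n k m, OF A(1,2)] support_block_partition[OF k A(3)] z(1)])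
      (use z(2) fin A(1) in \<open>auto simp: block_partition_def\<close>)
  also have "{v\<in>A. v < z k} = A - {Max A}" using z(2) fin by (auto simp: less_le)
  also have "card (A - {Max A}) = card A - 1" using fin A(1) by simp
  also have "card A - 1 < card {v\<in>A. z(k := v) \<in> S} \<longleftrightarrow> card {v\<in>A. z(k := v) \<in> S} = card A"
    using card_mono[OF fin, of "{v\<in>A. z(k := v) \<in> S}"] fin A(1) card_gt_0_iff[of A] by fastforce
  also have "\<dots> \<longleftrightarrow> {v\<in>A. z(k := v) \<in> S} = A"
    using card_subset_eq[OF fin, of "{v\<in>A. z(k := v) \<in> S}"] by auto
  finally show ?thesis by blast
qed

lemma override_on_insert_upd:
  assumes "k \<notin> X"
  shows "override_on z (x(k := v)) (insert k X) = (override_on z x X)(k := v)"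
  using assms by (auto simp: override_on_def)

text \<open>Each push down contributes one existential quantifier. The first in the list acts on
  \<open>S\<close> itself and gives the innermost one, so the induction hypothesis is used with the
  pushed down set in place of \<open>S\<close>.\<close>

lemma serial_push_down_blocks_Min:
  assumes V: "\<And>i. i \<in> {1..m} \<Longrightarrow> V i \<noteq> {} \<and> V i \<subseteq> {..<n i}"
    and "distinct ks" "set ks \<subseteq> {1..m}" "\<And>k. k \<in> set ks \<Longrightarrow> \<not> is_singleton (V k) \<and> z k = Min (V k)"
    and z: "z \<in> PiE {1..m} V"
  shows "z \<in> serial_push_down m S (map (\<lambda>k. block_partition n k (V k)) ks) \<longleftrightarrow>
    (\<exists>y\<in>PiE {1..m} V. override_on z y (set ks) \<in> S)"
  using assms(2-4)
proof (induction ks arbitrary: S)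
  case Nil
  then show ?case using z by (auto simp: serial_push_down_def)
next
  case (Cons k ks)
  then have k: "k \<in> {1..m}" "\<not> is_singleton (V k)" "k \<notin> set ks" by auto
  have univ: "PiE {1..m} V \<subseteq> universe m n" unfolding universe_def by (rule PiE_mono) (use V in blast)
  \<comment> \<open>As \<open>k\<close> is not in \<open>ks\<close>, overriding on
    \<open>set ks\<close> leaves the \<open>k\<close>-th coordinate at
    \<open>Min (V k)\<close>.\<close>
  have step: "override_on z y (set ks) \<in> push_down m S (block_partition n k (V k)) \<longleftrightarrow>
      (\<exists>v\<in>V k. (override_on z y (set ks))(k := v) \<in> S)" if "y \<in> PiE {1..m} V" for y
    by (rule push_down_block_Min[OF k(1) _ _ k(2)])
      (use V[OF k(1)] univ override_on_in_PiE[OF z that] Cons.prems k(3) in auto)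
  have "z \<in> serial_push_down m S (map (\<lambda>k. block_partition n k (V k)) (k # ks)) \<longleftrightarrow>
      (\<exists>y\<in>PiE {1..m} V. override_on z y (set ks) \<in> push_down m S (block_partition n k (V k)))"
    using Cons.IH Cons.prems by (simp add: serial_push_down_def)
  also have "\<dots> \<longleftrightarrow> (\<exists>y\<in>PiE {1..m} V. \<exists>v\<in>V k. (override_on z y (set ks))(k := v) \<in> S)"
    using step by blast
  also have "\<dots> \<longleftrightarrow> (\<exists>y\<in>PiE {1..m} V. override_on z y (set (k # ks)) \<in> S)"
  proof safe
    fix y v assume y: "y \<in> PiE {1..m} V" "v \<in> V k" "(override_on z y (set ks))(k := v) \<in> S"
    have "y(k := v) \<in> PiE {1..m} V" using fun_upd_in_PiE'[of y _ V k "V k"] y k by simp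
    then show "\<exists>y\<in>PiE {1..m} V. override_on z y (set (k # ks)) \<in> S"
      using y(3) override_on_insert_upd[OF k(3), of z y v] by (intro bexI[of _ "y(k := v)"]) auto
  next
    fix y assume y: "y \<in> PiE {1..m} V" "override_on z y (set (k # ks)) \<in> S"
    then show "\<exists>y\<in>PiE {1..m} V. \<exists>v\<in>V k. (override_on z y (set ks))(k := v) \<in> S"
      using override_on_insert_upd[OF k(3), of z y "y k"] PiE_mem[OF y(1) k(1)]
      by (intro bexI[of _ y] bexI[of _ "y k"]) auto
  qed
  finally show ?case .
qed

text \<open>The dual induction: at the maxima each push down contributes a universal
  quantifier.\<close>

lemma serial_push_down_blocks_Max:
  assumes V: "\<And>i. i \<in> {1..m} \<Longrightarrow> V i \<noteq> {} \<and> V i \<subseteq> {..<n i}"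
    and "distinct ks" "set ks \<subseteq> {1..m}" "\<And>k. k \<in> set ks \<Longrightarrow> \<not> is_singleton (V k) \<and> z k = Max (V k)"
    and z: "z \<in> PiE {1..m} V"
  shows "z \<in> serial_push_down m S (map (\<lambda>k. block_partition n k (V k)) ks) \<longleftrightarrow>
    (\<forall>x\<in>PiE {1..m} V. override_on z x (set ks) \<in> S)"
  using assms(2-4)
proof (induction ks arbitrary: S)
  case Nil
  then show ?case using z by (auto simp: serial_push_down_def)
next
  case (Cons k ks)
  then have k: "k \<in> {1..m}" "\<not> is_singleton (V k)" "k \<notin> set ks" by auto
  have univ: "PiE {1..m} V \<subseteq> universe m n" unfolding universe_def by (rule PiE_mono) (use V in blast)
  have step: "override_on z x (set ks) \<in> push_down m S (block_partition n k (V k)) \<longleftrightarrow>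
      (\<forall>v\<in>V k. (override_on z x (set ks))(k := v) \<in> S)" if "x \<in> PiE {1..m} V" for x
    by (rule push_down_block_Max[OF k(1) _ _ k(2)])
      (use V[OF k(1)] univ override_on_in_PiE[OF z that] Cons.prems k(3) in auto)
  have "z \<in> serial_push_down m S (map (\<lambda>k. block_partition n k (V k)) (k # ks)) \<longleftrightarrow>
      (\<forall>x\<in>PiE {1..m} V. override_on z x (set ks) \<in> push_down m S (block_partition n k (V k)))"
    using Cons.IH Cons.prems by (simp add: serial_push_down_def)
  also have "\<dots> \<longleftrightarrow> (\<forall>x\<in>PiE {1..m} V. \<forall>v\<in>V k. (override_on z x (set ks))(k := v) \<in> S)"
    using step by blast
  also have "\<dots> \<longleftrightarrow> (\<forall>x\<in>PiE {1..m} V. override_on z x (set (k # ks)) \<in> S)"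
  proof safe
    fix x v assume x: "x \<in> PiE {1..m} V" "v \<in> V k"
      and all: "\<forall>x\<in>PiE {1..m} V. override_on z x (set (k # ks)) \<in> S"
    have "x(k := v) \<in> PiE {1..m} V" using fun_upd_in_PiE'[of x _ V k "V k"] x k by simp
    then show "(override_on z x (set ks))(k := v) \<in> S"
      using all override_on_insert_upd[OF k(3), of z x v] by (metis list.simps(15))
  next
    fix x assume x: "x \<in> PiE {1..m} V"
      and all: "\<forall>x\<in>PiE {1..m} V. \<forall>v\<in>V k. (override_on z x (set ks))(k := v) \<in> S"
    then show "override_on z x (set (k # ks)) \<in> S"
      using override_on_insert_upd[OF k(3), of z x "x k"] PiE_mem[OF x k(1)] by simp
  qed
  finally show ?case .
qed

text \<open>One point \<open>e\<close> is tested in two orders. The blocks pushed last give the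
  outer quantifier: \<open>ys @ xs\<close> evaluates forall-exists at \<open>e\<close>, and
  \<open>xs @ ys\<close> evaluates exists-forall.\<close>

lemma commuting_imp_exchangeable:
  assumes comm: "\<And>\<Lambda>s p. \<lbrakk>\<forall>\<Lambda>\<in>set \<Lambda>s. generalized_partition m n \<Lambda> \<and> one_dimensional m \<Lambda>;
      distinct (map (support m) \<Lambda>s); p permutes {..<length \<Lambda>s}\<rbrakk> \<Longrightarrow>
      serial_push_down m S \<Lambda>s = serial_push_down m S (permute_list p \<Lambda>s)"
  shows "exchangeable m n S"
  unfolding exchangeable_def
proof (intro allI impI)
  fix V X
  assume V: "\<forall>i\<in>{1..m}. V i \<noteq> {} \<and> V i \<subseteq> {..<n i}"
    and H: "\<forall>x\<in>PiE {1..m} V. \<exists>y\<in>PiE {1..m} V. override_on y x X \<in> S"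
  \<comment> \<open>Coordinates with singleton \<open>V i\<close> are left out: their block partition is not one-dimensional.\<close>
  define big where "big = filter (\<lambda>i. \<not> is_singleton (V i)) [1..<Suc m]"
  define xs where "xs = filter (\<lambda>i. i \<in> X) big"
  define ys where "ys = filter (\<lambda>i. i \<notin> X) big"
  \<comment> \<open>Maxima on the universal coordinates and minima on the existential ones, as the
    two evaluation lemmas require.\<close>
  define e where "e = (\<lambda>i\<in>{1..m}. if i \<in> X then Max (V i) else Min (V i))"
  let ?\<beta> = "\<lambda>k. block_partition n k (V k)"
  have V': "V i \<noteq> {} \<and> V i \<subseteq> {..<n i}" if "i \<in> {1..m}" for i using V that by blast
  have fin: "finite (V i)" if "i \<in> {1..m}" for i using V'[OF that] finite_subset by blast
  have sets: "set xs = {i\<in>{1..m}. \<not> is_singleton (V i) \<and> i \<in> X}"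
    "set ys = {i\<in>{1..m}. \<not> is_singleton (V i) \<and> i \<notin> X}"
    by (auto simp: xs_def ys_def big_def)
  have dist: "distinct xs" "distinct ys" "distinct (ys @ xs)"
    using sets by (auto simp: xs_def ys_def big_def)
  have e: "e \<in> PiE {1..m} V" using V' fin by (auto simp: e_def)
  \<comment> \<open>On a coordinate outside both lists either \<open>V i\<close> is a singleton or
    all tuples are undefined, so \<open>e\<close>, \<open>x\<close> and \<open>y\<close> agree there
    and the two overrides combine to \<open>override_on y x X\<close> in either order.\<close>
  have exy: "override_on (override_on e x (set xs)) y (set ys) = override_on y x X"
    and eyx: "override_on (override_on e y (set ys)) x (set xs) = override_on y x X"
    if x: "x \<in> PiE {1..m} V" and y: "y \<in> PiE {1..m} V" for x y
  proof -
    have "e i = x i \<and> y i = x i" if "i \<notin> set xs" "i \<notin> set ys" for i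
    proof (cases "i \<in> {1..m}")
      case True
      then have "is_singleton (V i)" using that sets by auto
      then show ?thesis using PiE_mem[OF x True] PiE_mem[OF y True] PiE_mem[OF e True]
        by (auto simp: is_singleton_def)
    next
      case False
      then show ?thesis using PiE_arb[OF x False] PiE_arb[OF y False] PiE_arb[OF e False] by simp
    qed
    moreover have "set xs \<subseteq> X" "set ys \<inter> X = {}" using sets by auto
    ultimately show "override_on (override_on e x (set xs)) y (set ys) = override_on y x X"
      "override_on (override_on e y (set ys)) x (set xs) = override_on y x X"
      by (auto simp: override_on_def fun_eq_iff)
  qed
  have \<beta>: "generalized_partition m n (?\<beta> k) \<and> support m (?\<beta> k) = {k}" if "k \<in> set (ys @ xs)" for k
    using that sets V generalized_partition_block_partition support_block_partition by auto
  have "mset (map ?\<beta> (xs @ ys)) = mset (map ?\<beta> (ys @ xs))" by simp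
  then obtain p where p: "p permutes {..<length (map ?\<beta> (ys @ xs))}"
    "permute_list p (map ?\<beta> (ys @ xs)) = map ?\<beta> (xs @ ys)"
    by (rule mset_eq_permutation)
  have "inj_on (\<lambda>k. support m (?\<beta> k)) (set (ys @ xs))"
    using \<beta> by (intro inj_onI) (metis singleton_inject)
  then have distinct: "distinct (map (support m) (map ?\<beta> (ys @ xs)))"
    using dist(3) by (simp only: map_map distinct_map comp_def)
  have one: "\<forall>\<Lambda>\<in>set (map ?\<beta> (ys @ xs)). generalized_partition m n \<Lambda> \<and> one_dimensional m \<Lambda>"
    using \<beta> by (auto simp: one_dimensional_def)
  have eq: "serial_push_down m S (map ?\<beta> (ys @ xs)) = serial_push_down m S (map ?\<beta> (xs @ ys))"
    using comm[OF one distinct p(1)] unfolding p(2) .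
  have app: "serial_push_down m S (map ?\<beta> (as @ bs)) =
      serial_push_down m (serial_push_down m S (map ?\<beta> as)) (map ?\<beta> bs)" for as bs
    by (simp add: serial_push_down_def)
  have Mx: "z \<in> serial_push_down m T (map ?\<beta> xs) \<longleftrightarrow> (\<forall>x\<in>PiE {1..m} V. override_on z x (set xs) \<in> T)"
    if "z \<in> PiE {1..m} V" "\<And>i. i \<in> set xs \<Longrightarrow> z i = e i" for z T
    by (rule serial_push_down_blocks_Max[OF V' dist(1)]) (use that sets in \<open>auto simp: e_def\<close>)
  have Mn: "z \<in> serial_push_down m T (map ?\<beta> ys) \<longleftrightarrow> (\<exists>y\<in>PiE {1..m} V. override_on z y (set ys) \<in> T)"
    if "z \<in> PiE {1..m} V" "\<And>i. i \<in> set ys \<Longrightarrow> z i = e i" for z T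
    by (rule serial_push_down_blocks_Min[OF V' dist(2)]) (use that sets in \<open>auto simp: e_def\<close>)
  \<comment> \<open>The outer evaluation changes only its own coordinates, so the inner one still
    finds the minima, or in \<open>keep'\<close> the maxima, of \<open>e\<close>.\<close>
  have keep: "override_on e x (set xs) i = e i" if "i \<in> set ys" for x i
    using that sets by (auto simp: override_on_def)
  have keep': "override_on e y (set ys) i = e i" if "i \<in> set xs" for y i
    using that sets by (auto simp: override_on_def)
  have "e \<in> serial_push_down m S (map ?\<beta> (ys @ xs))"
    unfolding app Mx[OF e refl]
  proof
    fix x assume x: "x \<in> PiE {1..m} V"
    then obtain y where "y \<in> PiE {1..m} V" "override_on y x X \<in> S" using H by blast
    then show "override_on e x (set xs) \<in> serial_push_down m S (map ?\<beta> ys)"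
      using Mn[OF override_on_in_PiE[OF e x] keep] exy[OF x] by auto
  qed
  then have "e \<in> serial_push_down m S (map ?\<beta> (xs @ ys))" using eq by simp
  then obtain y where y: "y \<in> PiE {1..m} V" "override_on e y (set ys) \<in> serial_push_down m S (map ?\<beta> xs)"
    unfolding app Mn[OF e refl] by blast
  then have "override_on y x X \<in> S" if "x \<in> PiE {1..m} V" for x
    using Mx[OF override_on_in_PiE[OF e y(1)] keep'] eyx[OF that y(1)] that by auto
  then show "\<exists>y\<in>PiE {1..m} V. \<forall>x\<in>PiE {1..m} V. override_on y x X \<in> S" using y(1) by blast
qed

theorem theorem4:
  fixes m :: nat and n :: "nat \<Rightarrow> nat" and S :: "(nat \<Rightarrow> nat) set"
  assumes "\<forall>i\<in>{1..m}. 0 < n i"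
    and "S \<subseteq> universe m n"
  shows "ample m n S \<longleftrightarrow>
    (\<forall>\<Lambda>s p.
       (\<forall>\<Lambda>\<in>set \<Lambda>s. generalized_partition m n \<Lambda> \<and> one_dimensional m \<Lambda>) \<and>
       distinct (map (support m) \<Lambda>s) \<and>
       p permutes {..<length \<Lambda>s} \<longrightarrow>
       serial_push_down m S \<Lambda>s = serial_push_down m S (permute_list p \<Lambda>s))"
proof
  assume "ample m n S"
  then have "exchangeable m n S" by (rule ample_imp_exchangeable)
  then show "\<forall>\<Lambda>s p.
       (\<forall>\<Lambda>\<in>set \<Lambda>s. generalized_partition m n \<Lambda> \<and> one_dimensional m \<Lambda>) \<and>
       distinct (map (support m) \<Lambda>s) \<and>
       p permutes {..<length \<Lambda>s} \<longrightarrow>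
       serial_push_down m S \<Lambda>s = serial_push_down m S (permute_list p \<Lambda>s)"
    using serial_push_down_permute by (metis mset_permute_list)
next
  assume "\<forall>\<Lambda>s p.
       (\<forall>\<Lambda>\<in>set \<Lambda>s. generalized_partition m n \<Lambda> \<and> one_dimensional m \<Lambda>) \<and>
       distinct (map (support m) \<Lambda>s) \<and>
       p permutes {..<length \<Lambda>s} \<longrightarrow>
       serial_push_down m S \<Lambda>s = serial_push_down m S (permute_list p \<Lambda>s)"
  then have "exchangeable m n S" by (intro commuting_imp_exchangeable) blast
  then show "ample m n S" by (rule exchangeable_imp_ample[OF _ assms(1)])
qed

end
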